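(* Let $d$ be a proper angle distance and let $k \in \mathbb{N}$ be fixed. Then \[ N^{d}(k, n) = \Theta(n^{2k}) \quad \text{as } n \rightarrow \infty, \] that is, there exist constants $c, C > 0$ and $n_0$ (not depending on $n$) such that $c\, n^{2k} \leq N^d(k,n) \leq C\, n^{2k}$ for all $n \geq n_0$.
   Context: $\mathbb{N}$ denotes the positive integers. $\mathrm{Gr}(k,n)$ is the set of all $k$-dimensional linear subspaces of $\mathbb{R}^n$ (with the standard inner product). Principal angles: for $U,V \in \mathrm{Gr}(k,n)$ the $k$ principal angles $0 \leq \theta_1 \leq \dots \leq \theta_k \leq \pi/2$ between $U$ and $V$ are defined recursively: choose unit vectors $u \in U$, $v \in V$ maximizing $\langle u, v\rangle$ and set $\theta_1 = \arccos \langle u, v \rangle$; then $\theta_2,\dots,\theta_k$ are the principal angles between the $(k-1)$-dimensional subspaces $\{u' \in U : u' \perp u\}$ and $\{v' \in V : v' \perp v\}$. Equivalently, if $\mathbf{U}, \mathbf{V}$ are $n \times k$ matrices whose columns form orthonormal bases of $U$ and $V$, then $\cos\theta_1, \dots, \cos\theta_k$ are the singular values of $\mathbf{U}^{\intercal}\mathbf{V}$ (with multiplicity). Write $\theta_i(U,V)$ for the $i$-th principal angle. Angle distance: a function $d : \mathrm{Gr}(k,n)^2 \to \mathbb{R}$ is called an angle distance if $d(U,V) \in \{\theta_1(U,V), \dots, \theta_k(U,V)\}$ for all $U,V \in \mathrm{Gr}(k,n)$. It is proper if moreover $d(U,V) = 0$ if and only if $U = V$. In the asymptotic statement, $d$ denotes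 a proper angle distance on $\mathrm{Gr}(k,n)$ for each $n \geq k$ (a family indexed by $n$). For real $\alpha$, $N^d_\alpha(k,n)$ is the maximum size of a set $H \subseteq \mathrm{Gr}(k,n)$ such that $d(U,V) = \alpha$ for all $U \neq V$ in $H$, and $N^d(k,n) = \max_\alpha N^d_\alpha(k,n)$. *)

theory Defs
  imports "Jordan_Normal_Form.VS_Connect" "HOL-Library.Extended_Real"
begin

definition Gr :: "nat \<Rightarrow> nat \<Rightarrow> real vec set set" where
  "Gr k n =
    {U. VectorSpace.subspace class_ring U (module_vec TYPE(real) n) \<and>
        vectorspace.dim class_ring ((module_vec TYPE(real) n)\<lparr>carrier := U\<rparr>) = k}"

definition principal_vectors :: "real vec set \<Rightarrow> real vec set \<Rightarrow> real vec \<times> real vec" where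
  "principal_vectors U V =
    arg_max (\<lambda>(u, v). u \<bullet> v)
      (\<lambda>(u, v). u \<in> U \<and> v \<in> V \<and> u \<bullet> u = 1 \<and> v \<bullet> v = 1)"

text \<open>Angles are indexed from 0: the angle $\theta_i$ between \<open>k\<close>-dimensional
  subspaces is \<open>principal_angle (i - 1)\<close>, so only the indices below \<open>k\<close> are meaningful.
  The maximizing pair is fixed by Hilbert choice; the resulting angles do not depend on it,
  being the arccosines of the singular values of $\mathbf{U}^T\mathbf{V}$ for orthonormal
  bases $\mathbf{U}$, $\mathbf{V}$.\<close>

primrec principal_angle :: "nat \<Rightarrow> real vec set \<Rightarrow> real vec set \<Rightarrow> real" where
  "principal_angle 0 U V = (case principal_vectors U V of (u, v) \<Rightarrow> arccos (u \<bullet> v))"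
| "principal_angle (Suc i) U V =
    (case principal_vectors U V of (u, v) \<Rightarrow>
      principal_angle i {u' \<in> U. u' \<bullet> u = 0} {v' \<in> V. v' \<bullet> v = 0})"

definition angle_distance ::
  "nat \<Rightarrow> nat \<Rightarrow> (real vec set \<Rightarrow> real vec set \<Rightarrow> real) \<Rightarrow> bool" where
  "angle_distance k n d \<longleftrightarrow>
    (\<forall>U \<in> Gr k n. \<forall>V \<in> Gr k n. d U V \<in> (\<lambda>i. principal_angle i U V) ` {..<k})"

definition proper_angle_distance ::
  "nat \<Rightarrow> nat \<Rightarrow> (real vec set \<Rightarrow> real vec set \<Rightarrow> real) \<Rightarrow> bool" where
  "proper_angle_distance k n d \<longleftrightarrow>
    angle_distance k n d \<and> (\<forall>U \<in> Gr k n. \<forall>V \<in> Gr k n. d U V = 0 \<longleftrightarrow> U = V)"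

definition equidistant_sets ::
  "(real vec set \<Rightarrow> real vec set \<Rightarrow> real) \<Rightarrow> real \<Rightarrow> nat \<Rightarrow> nat \<Rightarrow> real vec set set set" where
  "equidistant_sets d \<alpha> k n = {H. H \<subseteq> Gr k n \<and> pairwise (\<lambda>U V. d U V = \<alpha>) H}"

text \<open>Sizes are extended naturals, so that infinite sets count as infinite (whereas \<^const>\<open>card\<close>
  gives them size 0) and unbounded sizes have supremum \<open>\<infinity>\<close>. A finite supremum of a nonempty
  set of extended naturals is attained, hence is a maximum.\<close>

definition set_size :: "'a set \<Rightarrow> enat" where
  "set_size A = (if finite A then enat (card A) else \<infinity>)"

definition max_equidistant_at ::
  "(real vec set \<Rightarrow> real vec set \<Rightarrow> real) \<Rightarrow> real \<Rightarrow> nat \<Rightarrow> nat \<Rightarrow> enat" where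
  "max_equidistant_at d \<alpha> k n = (SUP H \<in> equidistant_sets d \<alpha> k n. set_size H)"

definition max_equidistant ::
  "(real vec set \<Rightarrow> real vec set \<Rightarrow> real) \<Rightarrow> nat \<Rightarrow> nat \<Rightarrow> enat" where
  "max_equidistant d k n = (SUP \<alpha>. max_equidistant_at d \<alpha> k n)"

end

theory Submission
  imports Defs "HOL-Algebra.Algebraic_Closure_Type" "HOL-Library.Z2"
    "HOL-Analysis.Function_Topology" "Jordan_Normal_Form.Determinant"
begin

text \<open>The angle \<open>\<theta>\<close> is one of the principal angles between \<open>U\<close> and \<open>V\<close> only if \<open>c = cos \<theta>\<close> is a
  singular value of the pair: there are unit vectors \<open>u\<close> in \<open>U\<close> and \<open>v\<close> in \<open>V\<close> such that the
  orthogonal projections satisfy \<open>P\<^sub>V u = c v\<close> and \<open>P\<^sub>U v = c u\<close> (\<open>principal_angle_singular_pair\<close>).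
  This one-sided description of the principal angles is all that either bound uses.

  Upper bound, \<open>n ^ (2 * k)\<close> (\<open>max_equidistant_upper_bound\<close>). Let all distances in a family be
  \<open>\<alpha> \<noteq> 0\<close>, and let \<open>c = cos \<alpha>\<close>. For each member \<open>U\<close> with orthonormal basis \<open>a\<^sub>1, \<dots>, a\<^sub>k\<close> consider the
  function that sends \<open>V\<close> to the determinant of the \<open>k \<times> k\<close> matrix with entries
  \<open>a\<^sub>i \<bullet> (P\<^sub>V - c\<^sup>2 I) a\<^sub>j\<close>. It vanishes for every other member \<open>V\<close>, since \<open>P\<^sub>U P\<^sub>V u = c\<^sup>2 u\<close>, and
  takes the value \<open>(1 - c\<^sup>2) ^ k \<noteq> 0\<close> for \<open>V = U\<close>. These functions are therefore linearly independent.
  Each of them is a homogeneous polynomial of degree \<open>k\<close> in the \<open>n\<^sup>2\<close> entries of \<open>P\<^sub>V - c\<^sup>2 I\<close>, hence a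
  combination of \<open>n ^ (2 * k)\<close> monomials (\<open>common_singular_value_bound\<close>).

  Lower bound (\<open>max_equidistant_lower_bound_power\<close>). For \<open>k = 1\<close> the problem asks for quadratically
  many equiangular lines. They come from de Caen's construction: a Kerdock set of quadratic forms
  on \<open>\<F> \<oplus> \<F>\<^sub>2\<close>, where \<open>\<F>\<close> is the field with \<open>2 ^ r\<close> elements and \<open>r\<close> is odd, yields \<open>2 ^ r\<close> mutually
  unbiased bases of \<open>\<real> ^ N\<close>, \<open>N = 2 ^ (r + 1)\<close>. Appending to the vectors of each basis a new private
  coordinate with the right value makes all inner products equal in absolute value
  (\<open>equiangular_lines\<close>). For larger \<open>k\<close>, split \<open>\<real> ^ n\<close> into \<open>k\<close> orthogonal blocks of dimension about
  \<open>n / k\<close>, and take all direct sums of one line from each block. Every principal angle between two such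
  sums is either \<open>0\<close> or the common angle of the lines. A proper angle distance may not choose \<open>0\<close>
  between different subspaces, so it is forced to be constant on the family, whichever angle it
  selects elsewhere (\<open>max_equidistant_lower_bound\<close>).\<close>

no_notation fps_nth (infixl "$" 75)

section \<open>Orthonormal frames and the Grassmannian\<close>

text \<open>Defined entrywise, so that inner products of linear combinations reduce to finite sums of reals.\<close>

definition combination :: "nat \<Rightarrow> nat \<Rightarrow> (nat \<Rightarrow> real vec) \<Rightarrow> (nat \<Rightarrow> real) \<Rightarrow> real vec" where
  "combination n k b c = vec n (\<lambda>s. \<Sum>i<k. c i * b i $ s)"

definition orthonormal :: "nat \<Rightarrow> nat \<Rightarrow> (nat \<Rightarrow> real vec) \<Rightarrow> bool" where
  "orthonormal n k b \<longleftrightarrow>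
     (\<forall>i<k. b i \<in> carrier_vec n) \<and> (\<forall>i<k. \<forall>j<k. b i \<bullet> b j = of_bool (i = j))"

definition orthonormal_basis :: "nat \<Rightarrow> nat \<Rightarrow> (nat \<Rightarrow> real vec) \<Rightarrow> real vec set \<Rightarrow> bool" where
  "orthonormal_basis n k b U \<longleftrightarrow> orthonormal n k b \<and> U = range (combination n k b)"

lemma combination_carrier [simp]: "combination n k b c \<in> carrier_vec n"
  by (simp add: combination_def)

lemma orthonormal_carrier: "orthonormal n k b \<Longrightarrow> i < k \<Longrightarrow> b i \<in> carrier_vec n"
  by (simp add: orthonormal_def)

lemma scalar_prod_combination:
  assumes "x \<in> carrier_vec n" "\<And>i. i < k \<Longrightarrow> b i \<in> carrier_vec n"
  shows "x \<bullet> combination n k b c = (\<Sum>i<k. c i * (x \<bullet> b i))"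
proof -
  have "x \<bullet> combination n k b c = (\<Sum>s<n. \<Sum>i<k. c i * (x $ s * b i $ s))"
    by (simp add: scalar_prod_def combination_def sum_distrib_left lessThan_atLeast0 mult_ac)
  also have "\<dots> = (\<Sum>i<k. c i * (\<Sum>s<n. x $ s * b i $ s))"
    by (subst sum.swap) (simp add: sum_distrib_left)
  also have "\<dots> = (\<Sum>i<k. c i * (x \<bullet> b i))"
  proof (intro sum.cong refl)
    fix i assume "i \<in> {..<k}"
    then have "dim_vec (b i) = n" using assms(2)[of i] by auto
    then show "c i * (\<Sum>s<n. x $ s * b i $ s) = c i * (x \<bullet> b i)"
      by (simp add: scalar_prod_def lessThan_atLeast0)
  qed
  finally show ?thesis .
qed

lemma combination_scalar_prod:
  assumes "x \<in> carrier_vec n" "\<And>i. i < k \<Longrightarrow> b i \<in> carrier_vec n"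
  shows "combination n k b c \<bullet> x = (\<Sum>i<k. c i * (b i \<bullet> x))"
proof -
  have "combination n k b c \<bullet> x = x \<bullet> combination n k b c"
    using assms(1) by (intro comm_scalar_prod[of _ n]) auto
  also have "\<dots> = (\<Sum>i<k. c i * (x \<bullet> b i))"
    by (rule scalar_prod_combination[OF assms])
  also have "\<dots> = (\<Sum>i<k. c i * (b i \<bullet> x))"
    using assms by (intro sum.cong refl) (simp add: comm_scalar_prod[of x n])
  finally show ?thesis .
qed

lemma orthonormal_coefficient:
  assumes "orthonormal n k b" "j < k"
  shows "combination n k b c \<bullet> b j = c j"
proof -
  have "combination n k b c \<bullet> b j = (\<Sum>i<k. c i * (b i \<bullet> b j))"
    using assms by (intro combination_scalar_prod) (auto simp: orthonormal_def)
  also have "\<dots> = (\<Sum>i<k. if i = j then c i else 0)"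
    using assms by (intro sum.cong refl) (auto simp: orthonormal_def)
  also have "\<dots> = c j" using assms(2) by simp
  finally show ?thesis .
qed

lemma scalar_prod_combinations:
  assumes "orthonormal n k b"
  shows "combination n k b c \<bullet> combination n k b e = (\<Sum>i<k. c i * e i)"
proof -
  have "combination n k b c \<bullet> combination n k b e
      = (\<Sum>i<k. e i * (combination n k b c \<bullet> b i))"
    using assms by (intro scalar_prod_combination) (auto simp: orthonormal_def)
  also have "\<dots> = (\<Sum>i<k. c i * e i)"
    using assms by (intro sum.cong refl) (simp add: orthonormal_coefficient)
  finally show ?thesis .
qed

lemma combination_of_bool:
  assumes "\<And>i. i < k \<Longrightarrow> b i \<in> carrier_vec n" "j < k"
  shows "combination n k b (\<lambda>i. of_bool (i = j)) = b j"
proof -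
  have "b j = vec n (\<lambda>s. b j $ s)" using assms by (intro eq_vecI) auto
  also have "\<dots> = combination n k b (\<lambda>i. of_bool (i = j))"
    unfolding combination_def using assms(2) by (intro arg_cong2[where f=vec] refl ext) (simp add: if_distrib if_distribR of_bool_def cong: if_cong)
  finally show ?thesis ..
qed

lemma orthonormal_basis_mem:
  "orthonormal_basis n k b U \<Longrightarrow> i < k \<Longrightarrow> b i \<in> U"
  unfolding orthonormal_basis_def orthonormal_def
  by (metis combination_of_bool rangeI)

lemma orthonormal_basis_carrier:
  "orthonormal_basis n k b U \<Longrightarrow> U \<subseteq> carrier_vec n"
  unfolding orthonormal_basis_def by auto

lemma orthonormal_basis_expand:
  assumes "orthonormal_basis n k b U" "x \<in> U"
  shows "x = combination n k b (\<lambda>i. x \<bullet> b i)"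
proof -
  obtain c where c: "x = combination n k b c"
    using assms by (auto simp: orthonormal_basis_def)
  have "combination n k b c = combination n k b (\<lambda>i. x \<bullet> b i)"
    using assms(1) unfolding c combination_def[of n k b] 
    by (intro arg_cong2[where f=vec] refl ext sum.cong)
       (simp add: combination_def[symmetric] orthonormal_coefficient orthonormal_basis_def)
  with c show ?thesis by simp
qed

lemma combination_eqI:
  "(\<And>i. i < k \<Longrightarrow> c i = e i) \<Longrightarrow> combination n k b c = combination n k b e"
  by (simp add: combination_def)

lemma inj_on_orthonormal: 
  assumes "orthonormal n k b" shows "inj_on b {..<k}"
proof (rule inj_onI)
  fix i j assume ij: "i \<in> {..<k}" "j \<in> {..<k}" "b i = b j"
  have "b i \<bullet> b j = of_bool (i = j)" "b i \<bullet> b i = of_bool (i = i)"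
    using assms ij(1,2) unfolding orthonormal_def by blast+
  then show "i = j" using ij(3) by (cases "i = j") simp_all
qed

context
  fixes n :: nat
begin
interpretation vec_space "TYPE(real)" n .

lemma lincomb_image_orthonormal:
  assumes "orthonormal n k b"
  shows "lincomb a (b ` {..<k}) = combination n k b (\<lambda>i. a (b i))"
proof (rule eq_vecI)
  have car: "b ` {..<k} \<subseteq> carrier_vec n" using assms by (auto simp: orthonormal_def)
  show "dim_vec (lincomb a (b ` {..<k})) = dim_vec (combination n k b (\<lambda>i. a (b i)))"
    using car by (simp add: combination_def lincomb_dim)
  fix s assume "s < dim_vec (combination n k b (\<lambda>i. a (b i)))"
  then have s: "s < n" by (simp add: combination_def)
  then show "lincomb a (b ` {..<k}) $ s = combination n k b (\<lambda>i. a (b i)) $ s"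
    using inj_on_orthonormal[OF assms] car
    by (simp add: lincomb_index combination_def sum.reindex)
qed

lemma span_orthonormal:
  assumes "orthonormal n k b"
  shows "span (b ` {..<k}) = range (combination n k b)"
proof -
  have car: "b ` {..<k} \<subseteq> carrier_vec n" using assms by (auto simp: orthonormal_def)
  have "span (b ` {..<k}) = range (\<lambda>a. lincomb a (b ` {..<k}))"
    using finite_span[OF _ car] by auto
  also have "\<dots> = range (combination n k b)"
  proof
    show "range (\<lambda>a. lincomb a (b ` {..<k})) \<subseteq> range (combination n k b)"
      by (auto simp: lincomb_image_orthonormal[OF assms])
    show "range (combination n k b) \<subseteq> range (\<lambda>a. lincomb a (b ` {..<k}))"
    proof
      fix x assume "x \<in> range (combination n k b)"
      then obtain c where "x = combination n k b c" by auto
      also have "\<dots> = lincomb (\<lambda>v. c (the_inv_into {..<k} b v)) (b ` {..<k})"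
        unfolding lincomb_image_orthonormal[OF assms]
        using inj_on_orthonormal[OF assms] by (intro combination_eqI) (simp add: the_inv_into_f_f)
      finally show "x \<in> range (\<lambda>a. lincomb a (b ` {..<k}))" by auto
    qed
  qed
  finally show ?thesis .
qed

lemma lin_indpt_orthonormal:
  assumes "orthonormal n k b"
  shows "lin_indpt (b ` {..<k})"
proof (rule finite_lin_indpt2)
  show "b ` {..<k} \<subseteq> carrier_vec n" using assms by (auto simp: orthonormal_def)
  fix a assume "lincomb a (b ` {..<k}) = 0\<^sub>v n"
  then have eq: "combination n k b (\<lambda>i. a (b i)) = 0\<^sub>v n"
    by (simp add: lincomb_image_orthonormal[OF assms])
  show "\<forall>v\<in>b ` {..<k}. a v = 0"
  proof safe
    fix j assume j: "j < k"
    then show "a (b j) = 0"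
      using orthonormal_coefficient[OF assms j, of "\<lambda>i. a (b i)"] orthonormal_carrier[OF assms j]
      unfolding eq by simp
  qed
qed auto

lemma orthonormal_le_dim:
  assumes "orthonormal n k b" shows "k \<le> n"
proof -
  have "card (b ` {..<k}) \<le> dim"
    using assms by (intro li_le_dim(2) fin_dim lin_indpt_orthonormal) (auto simp: orthonormal_def)
  then show ?thesis by (simp add: dim_is_n card_image inj_on_orthonormal[OF assms])
qed

text \<open>Orthonormality gives linear independence in the ambient space. Spans and linear independence do
  not change when they are taken inside the subspace, so the frame is a basis there and its length
  is the dimension.\<close>

lemma orthonormal_basis_imp_Gr:
  assumes "orthonormal_basis n k b U" shows "U \<in> Gr k n"
proof -
  let ?S = "b ` {..<k}"
  have ob: "orthonormal n k b" and U: "U = span ?S"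
    using assms span_orthonormal by (auto simp: orthonormal_basis_def)
  have car: "?S \<subseteq> carrier_vec n" using ob by (auto simp: orthonormal_def)
  have sub: "VectorSpace.subspace class_ring U V"
    unfolding U using car by (rule span_is_subspace)
  then have subm: "submodule class_ring U V"
    by (simp add: subspace_def)
  interpret U: vectorspace class_ring "vs U" using sub by (rule subspace_is_vs)
  have SU: "?S \<subseteq> U" unfolding U using in_own_span[OF car] .
  have "U.basis ?S"
    unfolding U.basis_def 
    using span_li_not_depend[OF SU subm] lin_indpt_orthonormal[OF ob] SU U by simp
  then have "U.dim = card ?S" by (intro U.dim_basis) auto
  then show ?thesis using sub
    by (simp add: Gr_def card_image inj_on_orthonormal[OF ob])
qed

lemma Gr_subspaceD:
  assumes "U \<in> Gr k n"
  shows "U \<subseteq> carrier_vec n" "x \<in> U \<Longrightarrow> a \<cdot>\<^sub>v x \<in> U" "x \<in> U \<Longrightarrow> y \<in> U \<Longrightarrow> x + y \<in> U"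
proof -
  have "submodule class_ring U V" using assms by (simp add: Gr_def subspace_def)
  then show "U \<subseteq> carrier_vec n" "x \<in> U \<Longrightarrow> a \<cdot>\<^sub>v x \<in> U" "x \<in> U \<Longrightarrow> y \<in> U \<Longrightarrow> x + y \<in> U"
    by (auto simp: submodule_def module_vec_simps class_ring_simps)
qed

lemma Gr_combination_closed:
  assumes "U \<in> Gr k n" "orthonormal n j b" "\<And>i. i < j \<Longrightarrow> b i \<in> U"
  shows "combination n j b c \<in> U"
proof -
  have "submodule class_ring U V" using assms(1) by (simp add: Gr_def subspace_def)
  then have "span (b ` {..<j}) \<subseteq> U" using assms(3) by (intro span_is_subset) auto
  then show ?thesis using span_orthonormal[OF assms(2)] by auto
qed

end

lemma scalar_prod_self_nonneg: "(x::real vec) \<bullet> x \<ge> 0"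
  by (auto simp: scalar_prod_def intro: sum_nonneg)

lemma scalar_prod_self_eq_0:
  assumes "(x::real vec) \<in> carrier_vec n" "x \<bullet> x = 0" shows "x = 0\<^sub>v n"
proof (rule eq_vecI)
  fix i assume "i < dim_vec (0\<^sub>v n :: real vec)"
  then have i: "i < n" by simp
  have "(\<Sum>i = 0..<n. x $ i * x $ i) = 0" using assms by (auto simp: scalar_prod_def)
  then have "\<forall>i\<in>{0..<n}. x $ i * x $ i = 0"
    by (subst (asm) sum_nonneg_eq_0_iff) auto
  then show "x $ i = 0\<^sub>v n $ i" using i by auto
qed (use assms in auto)

text \<open>Gram--Schmidt: while the frame does not span \<open>U\<close>, append the normalized component of some vector
  of \<open>U\<close> orthogonal to the frame. This stops because an orthonormal frame has at most \<open>n\<close> members, and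
  the length reached is the dimension \<open>k\<close>.\<close>

lemma orthonormal_basis_extension:
  assumes U: "U \<in> Gr k n" and "orthonormal n j b" "\<And>i. i < j \<Longrightarrow> b i \<in> U"
  shows "\<exists>b'. orthonormal_basis n k b' U \<and> (\<forall>i<j. b' i = b i)"
  using assms(2,3)
proof (induction "n - j" arbitrary: j b rule: less_induct)
  case less
  show ?case
  proof (cases "range (combination n j b) = U")
    case True
    then have "orthonormal_basis n j b U" using less by (simp add: orthonormal_basis_def)
    moreover from orthonormal_basis_imp_Gr[OF this] U have "j = k" by (simp add: Gr_def)
    ultimately show ?thesis by auto
  next
    case False
    have "range (combination n j b) \<subseteq> U"
      using Gr_combination_closed[OF U less.prems] by auto
    with False obtain x where x: "x \<in> U" "x \<notin> range (combination n j b)" by auto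
    define p where "p = combination n j b (\<lambda>i. x \<bullet> b i)"
    define y where "y = x + (-1) \<cdot>\<^sub>v p"
    have pU: "p \<in> U" unfolding p_def
      using Gr_combination_closed[OF U less.prems] by auto
    have yU: "y \<in> U" unfolding y_def by (intro Gr_subspaceD(2,3)[OF U] pU x(1))
    have car: "x \<in> carrier_vec n" "p \<in> carrier_vec n" "y \<in> carrier_vec n"
      using x(1) yU pU Gr_subspaceD(1)[OF U] by auto
    have y0: "y \<noteq> 0\<^sub>v n"
    proof
      assume y: "y = 0\<^sub>v n"
      have "x $ i = p $ i" if "i < n" for i
        using arg_cong[OF y, of "\<lambda>w. w $ i"] car(1,2) that by (simp add: y_def)
      then have "x = p" using car(1,2) by (intro eq_vecI) simp_all
      moreover have "p \<in> range (combination n j b)" unfolding p_def by (rule rangeI)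
      ultimately show False using x(2) by metis
    qed
    then have yy: "y \<bullet> y > 0"
      using scalar_prod_self_eq_0[OF car(3)] scalar_prod_self_nonneg[of y] by linarith
    define z where "z = (1 / sqrt (y \<bullet> y)) \<cdot>\<^sub>v y"
    have zU: "z \<in> U" unfolding z_def using yU Gr_subspaceD(2)[OF U] by blast
    have zc: "z \<in> carrier_vec n" using car by (simp add: z_def)
    have zz: "z \<bullet> z = 1" using car yy by (simp add: z_def)
    have zb: "z \<bullet> b i = 0" if "i < j" for i
    proof -
      have bi: "b i \<in> carrier_vec n" using less.prems(1) that by (rule orthonormal_carrier)
      have "p \<bullet> b i = x \<bullet> b i" unfolding p_def
        using less.prems(1) that by (rule orthonormal_coefficient)
      then show ?thesis using bi car by (simp add: z_def y_def add_scalar_prod_distrib[of _ n])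
    qed
    have bz: "b i \<bullet> z = 0" if "i < j" for i
      using zb[OF that] comm_scalar_prod[OF zc orthonormal_carrier[OF less.prems(1) that]] by simp
    have ob: "orthonormal n (Suc j) (b(j := z))"
      using less.prems(1) zz zb bz zc by (auto simp: orthonormal_def less_Suc_eq)
    have lt: "n - Suc j < n - j" using orthonormal_le_dim[OF ob] by linarith
    have mem: "(b(j := z)) i \<in> U" if "i < Suc j" for i
      using that less.prems(2)[of i] zU by (cases "i = j") simp_all
    obtain b' where b': "orthonormal_basis n k b' U" "\<forall>i<Suc j. b' i = (b(j := z)) i"
      using less.hyps[OF lt ob mem] by blast
    have "b' i = b i" if "i < j" for i
      using b'(2)[rule_format, of i] that by simp
    with b'(1) show ?thesis by blast
  qed
qed

lemma Gr_iff_orthonormal_basis: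
  "U \<in> Gr k n \<longleftrightarrow> (\<exists>b. orthonormal_basis n k b U)"
  using orthonormal_basis_extension[of U k n 0] orthonormal_basis_imp_Gr
  by (auto simp: orthonormal_def)

text \<open>In an orthonormal basis that begins with \<open>u\<close>, the remaining members span the complement. This is
  the drop of dimension in the recursion that defines the principal angles.\<close>

lemma Gr_orthogonal_complement_of_unit:
  assumes U: "U \<in> Gr (Suc k) n" and u: "u \<in> U" "u \<bullet> u = 1"
  shows "{x \<in> U. x \<bullet> u = 0} \<in> Gr k n"
proof -
  have "u \<in> carrier_vec n" using u Gr_subspaceD(1)[OF U] by auto
  then have "orthonormal n 1 (\<lambda>_. u)" using u by (auto simp: orthonormal_def)
  from orthonormal_basis_extension[OF U this] u
  obtain b where b: "orthonormal_basis n (Suc k) b U" and b0: "b 0 = u" by auto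
  have ob: "orthonormal n (Suc k) b" and Ub: "U = range (combination n (Suc k) b)"
    using b by (auto simp: orthonormal_basis_def)
  have shift: "combination n k (\<lambda>i. b (Suc i)) c = combination n (Suc k) b (case_nat 0 c)" for c
    unfolding combination_def sum.lessThan_Suc_shift by simp
  have "{x \<in> U. x \<bullet> u = 0} = range (combination n k (\<lambda>i. b (Suc i)))"
  proof (intro equalityI subsetI)
    fix x assume "x \<in> {x \<in> U. x \<bullet> u = 0}"
    then obtain c where c: "x = combination n (Suc k) b c" and "x \<bullet> u = 0" using Ub by auto
    then have "c 0 = 0" using orthonormal_coefficient[OF ob, of 0 c] b0 by simp
    then have "x = combination n (Suc k) b (case_nat 0 (\<lambda>i. c (Suc i)))"
      unfolding c by (intro combination_eqI) (auto split: nat.split)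
    then show "x \<in> range (combination n k (\<lambda>i. b (Suc i)))" by (simp add: shift[symmetric])
  next
    fix x assume "x \<in> range (combination n k (\<lambda>i. b (Suc i)))"
    then obtain c where c: "x = combination n (Suc k) b (case_nat 0 c)" by (auto simp: shift)
    then show "x \<in> {x \<in> U. x \<bullet> u = 0}"
      using orthonormal_coefficient[OF ob, of 0 "case_nat 0 c"] b0 Ub by simp
  qed
  moreover have "orthonormal n k (\<lambda>i. b (Suc i))" using ob by (simp add: orthonormal_def)
  ultimately have "orthonormal_basis n k (\<lambda>i. b (Suc i)) {x \<in> U. x \<bullet> u = 0}"
    by (simp add: orthonormal_basis_def)
  then show ?thesis by (rule orthonormal_basis_imp_Gr)
qed

section \<open>Principal angles and singular pairs\<close>

text \<open>The unit sphere of \<open>\<real> ^ k\<close>, placed in the product space of all real sequences by setting the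
  coordinates from \<open>k\<close> on to \<open>0\<close>. It is closed in the cube, which is compact by Tychonoff's theorem.\<close>

lemma compact_coordinate_sphere:
  "compact {c :: nat \<Rightarrow> real. (\<forall>i\<ge>k. c i = 0) \<and> (\<Sum>i<k. (c i)\<^sup>2) = 1}" (is "compact ?S")
proof -
  have "compactin (product_topology (\<lambda>_. euclidean) UNIV) (PiE UNIV (\<lambda>_::nat. {-1..1::real}))"
    unfolding compactin_PiE by simp
  then have comp: "compact (PiE UNIV (\<lambda>_::nat. {-1..1::real}))"
    unfolding euclidean_product_topology by simp
  have "closed {c::nat \<Rightarrow> real. c i = 0}" for i
    by (rule closed_Collect_eq[OF continuous_on_product_coordinates continuous_on_const])
  then have cl1: "closed {c::nat \<Rightarrow> real. \<forall>i. k \<le> i \<longrightarrow> c i = 0}"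
    by (intro closed_Collect_all closed_Collect_imp) simp_all
  have cl2: "closed {c::nat \<Rightarrow> real. (\<Sum>i<k. (c i)\<^sup>2) = 1}"
    by (rule closed_Collect_eq)
      (rule continuous_on_sum continuous_on_power continuous_on_product_coordinates continuous_on_const)+
  have cl: "closed ?S" using closed_Int[OF cl1 cl2] by (simp only: Collect_conj_eq[symmetric])
  have "?S \<subseteq> PiE UNIV (\<lambda>_. {-1..1})"
  proof
    fix c assume c: "c \<in> ?S"
    have "\<bar>c i\<bar> \<le> 1" for i
    proof (cases "i < k")
      case True
      then have "(c i)\<^sup>2 \<le> (\<Sum>i<k. (c i)\<^sup>2)" by (intro member_le_sum) auto
      then show ?thesis using c by (simp add: abs_square_le_1)
    qed (use c in auto)
    then have "- 1 \<le> c i \<and> c i \<le> 1" for i by (simp only: abs_le_iff) (metis minus_le_iff)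
    then show "c \<in> PiE UNIV (\<lambda>_. {-1..1})" by auto
  qed
  then have "PiE UNIV (\<lambda>_. {-1..1}) \<inter> ?S = ?S" by (rule inf_absorb2)
  with compact_Int_closed[OF comp cl] show ?thesis by simp
qed

text \<open>In orthonormal coordinates the inner product is a continuous function on a product of two
  compact spheres.\<close>

lemma unit_vectors_maximizer:
  assumes "orthonormal_basis n k a U" "orthonormal_basis n k b V" "k \<ge> 1"
  shows "\<exists>u\<in>U. \<exists>v\<in>V. u \<bullet> u = 1 \<and> v \<bullet> v = 1 \<and>
           (\<forall>x\<in>U. \<forall>y\<in>V. x \<bullet> x = 1 \<longrightarrow> y \<bullet> y = 1 \<longrightarrow> x \<bullet> y \<le> u \<bullet> v)"
proof -
  define S where "S = {c :: nat \<Rightarrow> real. (\<forall>i\<ge>k. c i = 0) \<and> (\<Sum>i<k. (c i)\<^sup>2) = 1}"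
  let ?f = "\<lambda>p. \<Sum>i<k. fst p i * (\<Sum>j<k. snd p j * (a i \<bullet> b j))"
  have oa: "orthonormal n k a" and ob: "orthonormal n k b"
    and U: "U = range (combination n k a)" and V: "V = range (combination n k b)"
    using assms by (auto simp: orthonormal_basis_def)
  have f: "combination n k a c \<bullet> combination n k b e = ?f (c, e)" for c e
  proof -
    have "combination n k a c \<bullet> combination n k b e = (\<Sum>i<k. c i * (a i \<bullet> combination n k b e))"
      by (rule combination_scalar_prod[OF combination_carrier orthonormal_carrier[OF oa]])
    also have "\<dots> = (\<Sum>i<k. c i * (\<Sum>j<k. e j * (a i \<bullet> b j)))"
      by (intro sum.cong refl arg_cong2[where f = times]
          scalar_prod_combination orthonormal_carrier[OF oa] orthonormal_carrier[OF ob]) simp_all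
    finally show ?thesis by simp
  qed
  have "(\<Sum>i<k. (of_bool (i = 0) :: real)\<^sup>2) = (\<Sum>i<k. if i = 0 then 1 else 0)"
    by (intro sum.cong refl) simp
  also have "\<dots> = 1" using assms(3) by simp
  finally have "(\<lambda>i. of_bool (i = 0)) \<in> S"
    using assms(3) unfolding S_def by (intro CollectI conjI allI impI) auto
  then have ne: "S \<times> S \<noteq> {}" by blast
  have cont: "continuous_on (S \<times> S) ?f"
  proof -
    have 1: "continuous_on A (\<lambda>p. fst p i)" for i and A :: "((nat \<Rightarrow> real) \<times> (nat \<Rightarrow> real)) set"
      by (rule continuous_on_compose2[OF continuous_on_product_coordinates
            continuous_on_fst[OF continuous_on_id]]) simp
    have 2: "continuous_on A (\<lambda>p. snd p i)" for i and A :: "((nat \<Rightarrow> real) \<times> (nat \<Rightarrow> real)) set"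
      by (rule continuous_on_compose2[OF continuous_on_product_coordinates
            continuous_on_snd[OF continuous_on_id]]) simp
    show ?thesis by (intro continuous_on_sum continuous_on_mult 1 2 continuous_on_const)
  qed
  have "compact (S \<times> S)" unfolding S_def by (intro compact_Times compact_coordinate_sphere)
  from continuous_attains_sup[OF this ne cont]
  obtain p where p: "p \<in> S \<times> S" and max_p: "\<forall>q\<in>S \<times> S. ?f q \<le> ?f p" ..
  obtain c e where ce_p: "p = (c, e)" by (cases p)
  have ce: "c \<in> S" "e \<in> S" using p unfolding ce_p by (rule SigmaD1, rule SigmaD2)
  have max: "?f (c', e') \<le> ?f (c, e)" if "c' \<in> S" "e' \<in> S" for c' e'
    using max_p SigmaI[OF that] unfolding ce_p by (rule bspec)
  have restr: "\<exists>c\<in>S. x = combination n k d c"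
    if "x = combination n k d c" "x \<bullet> x = 1" "orthonormal n k d" for x d c
  proof (intro bexI)
    show "x = combination n k d (\<lambda>i. if i < k then c i else 0)"
      unfolding that(1) by (intro combination_eqI) simp
    show "(\<lambda>i. if i < k then c i else 0) \<in> S"
      using that(2) by (auto simp: S_def that(1) scalar_prod_combinations[OF that(3)] power2_eq_square)
  qed
  show ?thesis
  proof (intro bexI conjI ballI impI)
    show "combination n k a c \<bullet> combination n k a c = 1"
      using ce(1) by (simp add: S_def scalar_prod_combinations[OF oa] power2_eq_square)
    show "combination n k b e \<bullet> combination n k b e = 1"
      using ce(2) by (simp add: S_def scalar_prod_combinations[OF ob] power2_eq_square)
    fix x y assume xy: "x \<in> U" "y \<in> V" "x \<bullet> x = 1" "y \<bullet> y = 1"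
    obtain c0 e0 where ce0: "x = combination n k a c0" "y = combination n k b e0"
      using xy(1,2) unfolding U V by blast
    obtain c' where c': "c' \<in> S" "x = combination n k a c'"
      using restr[OF ce0(1) xy(3) oa] by blast
    obtain e' where e': "e' \<in> S" "y = combination n k b e'"
      using restr[OF ce0(2) xy(4) ob] by blast
    show "x \<bullet> y \<le> combination n k a c \<bullet> combination n k b e"
      unfolding c'(2) e'(2) f by (rule max[OF c'(1) e'(1)])
  qed (unfold U V, rule rangeI, rule rangeI)
qed

text \<open>Because a maximizer exists, the choice made by \<^const>\<open>arg_max\<close> is one.\<close>

lemma principal_vectors_maximal:
  assumes "U \<in> Gr k n" "V \<in> Gr k n" "k \<ge> 1" "principal_vectors U V = (u, v)"
  shows "u \<in> U" "v \<in> V" "u \<bullet> u = 1" "v \<bullet> v = 1"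
    and "\<And>x y. x \<in> U \<Longrightarrow> y \<in> V \<Longrightarrow> x \<bullet> x = 1 \<Longrightarrow> y \<bullet> y = 1 \<Longrightarrow> x \<bullet> y \<le> u \<bullet> v"
proof -
  obtain a b where "orthonormal_basis n k a U" "orthonormal_basis n k b V"
    using assms by (auto simp: Gr_iff_orthonormal_basis)
  from unit_vectors_maximizer[OF this assms(3)]
  have "\<exists>p. is_arg_max (\<lambda>(u, v). u \<bullet> v)
      (\<lambda>(u, v). u \<in> U \<and> v \<in> V \<and> u \<bullet> u = 1 \<and> v \<bullet> v = 1) p"
    by (auto simp: is_arg_max_def not_less)
  then have "is_arg_max (\<lambda>(u, v). u \<bullet> v)
      (\<lambda>(u, v). u \<in> U \<and> v \<in> V \<and> u \<bullet> u = 1 \<and> v \<bullet> v = 1) (principal_vectors U V)"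
    unfolding principal_vectors_def arg_max_def by (rule someI_ex)
  then show "u \<in> U" "v \<in> V" "u \<bullet> u = 1" "v \<bullet> v = 1"
    and "\<And>x y. x \<in> U \<Longrightarrow> y \<in> V \<Longrightarrow> x \<bullet> x = 1 \<Longrightarrow> y \<bullet> y = 1 \<Longrightarrow> x \<bullet> y \<le> u \<bullet> v"
    unfolding assms(4) is_arg_max_def by (auto simp: not_less)
qed

text \<open>The projection of \<open>v\<close> to \<open>U\<close> is a multiple of the unit vector \<open>u\<close> of \<open>U\<close> that is nearest to \<open>v\<close>. Let
  \<open>g\<close> be the coordinates of the projection and \<open>a\<close> those of \<open>u\<close>. Maximality, tested on \<open>g / \<bar>g\<bar>\<close>, gives
  \<open>\<bar>g\<bar> \<le> v \<bullet> u\<close>. Expanding the square, \<open>\<bar>g - (v \<bullet> u) a\<bar>\<^sup>2 = \<bar>g\<bar>\<^sup>2 - (v \<bullet> u)\<^sup>2 \<le> 0\<close>.\<close>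

lemma nearest_unit_vector_is_projection:
  assumes b: "orthonormal_basis n k b U" and u: "u \<in> U" "u \<bullet> u = 1" and v: "v \<in> carrier_vec n"
    and max: "\<And>x. x \<in> U \<Longrightarrow> x \<bullet> x = 1 \<Longrightarrow> v \<bullet> x \<le> v \<bullet> u"
  shows "v \<bullet> u \<ge> 0" "\<And>x. x \<in> U \<Longrightarrow> v \<bullet> x = (v \<bullet> u) * (u \<bullet> x)"
proof -
  have ob: "orthonormal n k b" and U: "U = range (combination n k b)"
    using b by (auto simp: orthonormal_basis_def)
  obtain a where a: "u = combination n k b a" using u U by auto
  define g where "g = (\<lambda>i. v \<bullet> b i)"
  define G where "G = (\<Sum>i<k. (g i)\<^sup>2)"
  have vcomb: "v \<bullet> combination n k b c = (\<Sum>i<k. c i * g i)" for c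
    unfolding g_def using v ob by (intro scalar_prod_combination) (auto simp: orthonormal_def)
  have sqrtG: "sqrt G \<le> v \<bullet> u" 
  proof (cases "G = 0")
    case True
    then have "\<forall>i<k. g i = 0" unfolding G_def by (subst (asm) sum_nonneg_eq_0_iff) auto
    then show ?thesis by (simp add: a vcomb True)
  next
    case False
    then have G: "G > 0" by (simp add: G_def sum_nonneg less_le)
    define x where "x = combination n k b (\<lambda>i. g i / sqrt G)"
    have "x \<bullet> x = (\<Sum>i<k. (g i)\<^sup>2) / G"
      using G by (simp add: x_def scalar_prod_combinations[OF ob] sum_divide_distrib power2_eq_square)
    then have "x \<bullet> x = 1" using G by (simp add: G_def)
    moreover have "v \<bullet> x = (\<Sum>i<k. (g i)\<^sup>2) / sqrt G"
      by (simp add: x_def vcomb sum_divide_distrib power2_eq_square)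
    then have "v \<bullet> x = sqrt G" using G by (simp add: G_def[symmetric] real_div_sqrt)
    ultimately show ?thesis using max[of x] U by (auto simp: x_def)
  qed
  have "0 \<le> sqrt G" by (simp add: G_def sum_nonneg)
  with sqrtG show c0: "v \<bullet> u \<ge> 0" by linarith
  have "G \<le> (v \<bullet> u)\<^sup>2" using sqrtG c0 by (simp add: sqrt_le_D)
  have aa: "(\<Sum>i<k. (a i)\<^sup>2) = 1"
    using u(2) by (simp add: a scalar_prod_combinations[OF ob] power2_eq_square)
  \<comment> \<open>The mixed term is \<open>- 2 (v \<bullet> u)\<^sup>2\<close> because the sum of \<open>a i * g i\<close> is \<open>v \<bullet> u\<close>.\<close>
  have "(\<Sum>i<k. (g i - (v \<bullet> u) * a i)\<^sup>2)
      = G - 2 * (v \<bullet> u) * (\<Sum>i<k. a i * g i) + (v \<bullet> u)\<^sup>2 * (\<Sum>i<k. (a i)\<^sup>2)"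
    by (simp add: G_def power2_diff sum.distrib sum_subtractf sum_distrib_left power_mult_distrib mult_ac)
  also have "\<dots> = G - (v \<bullet> u)\<^sup>2" unfolding aa vcomb[symmetric] a[symmetric]
    by (simp add: power2_eq_square)
  finally have "(\<Sum>i<k. (g i - (v \<bullet> u) * a i)\<^sup>2) = 0"
    using \<open>G \<le> _\<close> sum_nonneg[of "{..<k}" "\<lambda>i. (g i - (v \<bullet> u) * a i)\<^sup>2"] by simp
  then have g: "\<forall>i<k. g i = (v \<bullet> u) * a i" by (subst (asm) sum_nonneg_eq_0_iff) auto
  fix x assume "x \<in> U"
  then obtain c where c: "x = combination n k b c" using U by auto
  show "v \<bullet> x = (v \<bullet> u) * (u \<bullet> x)"
    unfolding c vcomb unfolding a scalar_prod_combinations[OF ob] unfolding a[symmetric]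
    using g by (auto simp: sum_distrib_left mult_ac intro!: sum.cong)
qed

text \<open>A pair of singular vectors of \<open>U\<^sup>T V\<close> for the singular value \<open>c\<close>, without reference to bases: the
  two final conditions say that the projection of \<open>v\<close> to \<open>U\<close> is \<open>c u\<close> and that of \<open>u\<close> to \<open>V\<close> is \<open>c v\<close>.\<close>

definition singular_pair :: "real vec set \<Rightarrow> real vec set \<Rightarrow> real \<Rightarrow> real vec \<Rightarrow> real vec \<Rightarrow> bool" where
  "singular_pair U V c u v \<longleftrightarrow> u \<in> U \<and> v \<in> V \<and> u \<bullet> u = 1 \<and> v \<bullet> v = 1 \<and>
     (\<forall>x\<in>U. v \<bullet> x = c * (u \<bullet> x)) \<and> (\<forall>y\<in>V. u \<bullet> y = c * (v \<bullet> y))"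

lemma principal_vectors_singular_pair:
  assumes "U \<in> Gr k n" "V \<in> Gr k n" "k \<ge> 1" "principal_vectors U V = (u, v)"
  shows "singular_pair U V (u \<bullet> v) u v" "0 \<le> u \<bullet> v" "u \<bullet> v \<le> 1"
proof -
  note m = principal_vectors_maximal[OF assms]
  have car: "u \<in> carrier_vec n" "v \<in> carrier_vec n" "U \<subseteq> carrier_vec n" "V \<subseteq> carrier_vec n"
    using m(1,2) Gr_subspaceD(1)[OF assms(1)] Gr_subspaceD(1)[OF assms(2)] by auto
  obtain a b where ab: "orthonormal_basis n k a U" "orthonormal_basis n k b V"
    using assms by (auto simp: Gr_iff_orthonormal_basis)
  have comm: "x \<bullet> y = y \<bullet> x" if "x \<in> carrier_vec n" "y \<in> carrier_vec n" for x y :: "real vec"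
    using that by (rule comm_scalar_prod)
  have maxU: "v \<bullet> x \<le> v \<bullet> u" if "x \<in> U" "x \<bullet> x = 1" for x
    using m(5)[OF that(1) m(2) that(2) m(4)] comm[OF car(2)] comm[OF car(2,1)] that(1) car(3)
    by (simp add: subset_iff)
  have maxV: "u \<bullet> y \<le> u \<bullet> v" if "y \<in> V" "y \<bullet> y = 1" for y
    by (rule m(5)[OF m(1) that(1) m(3) that(2)])
  have "v \<bullet> x = (u \<bullet> v) * (u \<bullet> x)" if "x \<in> U" for x
    unfolding comm[OF car(1,2)]
    by (rule nearest_unit_vector_is_projection(2)[OF ab(1) m(1,3) car(2) maxU that])
  moreover have "u \<bullet> y = (u \<bullet> v) * (v \<bullet> y)" if "y \<in> V" for y
    by (rule nearest_unit_vector_is_projection(2)[OF ab(2) m(2,4) car(1) maxV that])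
  ultimately show "singular_pair U V (u \<bullet> v) u v"
    unfolding singular_pair_def using m(1-4) by blast
  show "0 \<le> u \<bullet> v"
    by (rule nearest_unit_vector_is_projection(1)[OF ab(2) m(2,4) car(1) maxV])
  have "(u - v) \<bullet> (u - v) = 2 - 2 * (u \<bullet> v)"
    using car(1,2) m(3,4) comm[OF car(1,2)]
    by (simp add: minus_scalar_prod_distrib[of _ n] scalar_prod_minus_distrib[of _ n])
  then show "u \<bullet> v \<le> 1" using scalar_prod_self_nonneg[of "u - v"] by simp
qed

text \<open>The first angle is given by the maximizing pair. For the others, a singular pair of the two
  complements is also one of \<open>U\<close> and \<open>V\<close>: its members are orthogonal to both principal vectors that
  were split off, so testing against those two directions gives \<open>0\<close> on both sides.\<close>

lemma principal_angle_singular_pair: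
  assumes "U \<in> Gr k n" "V \<in> Gr k n" "i < k"
  shows "\<exists>c u v. singular_pair U V c u v \<and> 0 \<le> c \<and> c \<le> 1 \<and> principal_angle i U V = arccos c"
  using assms
proof (induction i arbitrary: k U V)
  case 0
  obtain u v where uv: "principal_vectors U V = (u, v)" by fastforce
  show ?case using principal_vectors_singular_pair[OF 0(1,2) _ uv] 0(3) uv by auto
next
  case (Suc i)
  obtain k' where k: "k = Suc k'" using Suc.prems(3) by (cases k) auto
  obtain u v where uv: "principal_vectors U V = (u, v)" by fastforce
  note m = principal_vectors_maximal[OF Suc.prems(1,2) _ uv]
  note sp = principal_vectors_singular_pair[OF Suc.prems(1,2) _ uv]
  let ?U = "{x \<in> U. x \<bullet> u = 0}" and ?V = "{y \<in> V. y \<bullet> v = 0}"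
  have k1: "k \<ge> 1" using k by simp
  have gr: "?U \<in> Gr k' n" "?V \<in> Gr k' n"
    using Suc.prems(1,2) m(1-4)[OF k1] unfolding k
    by (blast intro: Gr_orthogonal_complement_of_unit)+
  have "i < k'" using Suc.prems(3) k by simp
  from Suc.IH[OF gr this] obtain c u' v' where
    c: "singular_pair ?U ?V c u' v'" "0 \<le> c" "c \<le> 1" "principal_angle i ?U ?V = arccos c"
    by blast
  have car: "U \<subseteq> carrier_vec n" "V \<subseteq> carrier_vec n"
    using Gr_subspaceD(1)[OF Suc.prems(1)] Gr_subspaceD(1)[OF Suc.prems(2)] by auto
  have u': "u' \<in> U" "u' \<bullet> u = 0" "u' \<bullet> u' = 1" and v': "v' \<in> V" "v' \<bullet> v = 0" "v' \<bullet> v' = 1"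
    using c(1) unfolding singular_pair_def by blast+
  \<comment> \<open>Every \<open>x\<close> in \<open>W\<close> differs from a vector orthogonal to \<open>w\<close> by a multiple of \<open>w\<close>,
    and neither side of the equation sees multiples of \<open>w\<close>.\<close>
  have lift: "q \<bullet> x = c * (p \<bullet> x)"
    if W: "W \<in> Gr k n" "w \<in> W" "w \<bullet> w = 1" and q: "q \<in> carrier_vec n" "q \<bullet> w = 0"
      and p: "p \<in> carrier_vec n" "p \<bullet> w = 0"
      and x: "x \<in> W" and h: "\<And>y. y \<in> W \<Longrightarrow> y \<bullet> w = 0 \<Longrightarrow> q \<bullet> y = c * (p \<bullet> y)" for W w p q x
  proof -
    have Wc: "W \<subseteq> carrier_vec n" using Gr_subspaceD(1)[OF W(1)] .
    define y where "y = x + (- (x \<bullet> w)) \<cdot>\<^sub>v w"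
    have "y \<in> W" unfolding y_def
      by (intro Gr_subspaceD(2,3)[OF W(1)] W(2) x)
    moreover have xw: "x \<in> carrier_vec n" "w \<in> carrier_vec n" using x W(2) Wc by auto
    then have "y \<bullet> w = 0"
      using W(3) by (simp add: y_def add_scalar_prod_distrib[of _ n])
    ultimately have "q \<bullet> y = c * (p \<bullet> y)" by (intro h)
    moreover have "q \<bullet> y = q \<bullet> x" "p \<bullet> y = p \<bullet> x"
      using q p xw by (simp_all add: y_def scalar_prod_add_distrib[of _ n])
    ultimately show ?thesis by simp
  qed
  have uc: "u \<in> carrier_vec n" "v \<in> carrier_vec n" "u' \<in> carrier_vec n" "v' \<in> carrier_vec n"
    using m(1,2)[OF k1] u' v' car by auto
  have "u \<bullet> v' = (u \<bullet> v) * (v \<bullet> v')" "v \<bullet> u' = (u \<bullet> v) * (u \<bullet> u')"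
    using sp(1)[OF k1] u'(1) v'(1) unfolding singular_pair_def by blast+
  then have orth: "v' \<bullet> u = 0" "u' \<bullet> v = 0"
    using u'(2) v'(2) comm_scalar_prod[of v n v'] comm_scalar_prod[of u n u']
      comm_scalar_prod[of v' n u] comm_scalar_prod[of u' n v] uc by simp_all
  have "v' \<bullet> x = c * (u' \<bullet> x)" if "x \<in> U" for x
  proof (rule lift[OF Suc.prems(1) m(1,3)[OF k1] uc(4) orth(1) uc(3) u'(2) that])
    show "v' \<bullet> y = c * (u' \<bullet> y)" if "y \<in> U" "y \<bullet> u = 0" for y
      using c(1) that unfolding singular_pair_def by blast
  qed
  moreover have "u' \<bullet> y = c * (v' \<bullet> y)" if "y \<in> V" for y
  proof (rule lift[OF Suc.prems(2) m(2,4)[OF k1] uc(3) orth(2) uc(4) v'(2) that])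
    show "u' \<bullet> x = c * (v' \<bullet> x)" if "x \<in> V" "x \<bullet> v = 0" for x
      using c(1) that unfolding singular_pair_def by blast
  qed
  ultimately have "singular_pair U V c u' v'"
    unfolding singular_pair_def using u'(1,3) v'(1,3) by blast
  then show ?case using c uv by auto
qed

section \<open>The polynomial bound for a common singular value\<close>

text \<open>Linear independence by evaluation: a nonsingular diagonal matrix of size \<open>h\<close> does not factor
  through fewer than \<open>h\<close> dimensions. Padded with zeros to square matrices, the factors would have
  determinant \<open>0\<close>.\<close>

lemma diagonal_factorization_bound:
  fixes A :: "nat \<Rightarrow> 'm \<Rightarrow> real" and B :: "'m \<Rightarrow> nat \<Rightarrow> real"
  assumes fin: "finite M"
    and diag: "\<And>i. i < h \<Longrightarrow> (\<Sum>m\<in>M. A i m * B m i) \<noteq> 0"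
    and off: "\<And>i j. i < h \<Longrightarrow> j < h \<Longrightarrow> i \<noteq> j \<Longrightarrow> (\<Sum>m\<in>M. A i m * B m j) = 0"
  shows "h \<le> card M"
proof (rule ccontr)
  assume "\<not> h \<le> card M"
  then have lt: "card M < h" by simp
  obtain e where e: "bij_betw e {..<card M} M"
    using ex_bij_betw_nat_finite[OF fin] by (auto simp: lessThan_atLeast0)
  define P where "P = mat h h (\<lambda>(i, m). if m < card M then A i (e m) else 0)"
  define Q where "Q = mat h h (\<lambda>(m, j). if m < card M then B (e m) j else 0)"
  have car: "P \<in> carrier_mat h h" "Q \<in> carrier_mat h h" by (simp_all add: P_def Q_def)
  have PQ: "(P * Q) $$ (i, j) = (\<Sum>m\<in>M. A i m * B m j)" if "i < h" "j < h" for i j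
  proof -
    have "(P * Q) $$ (i, j) = (\<Sum>m<h. if m < card M then A i (e m) * B (e m) j else 0)"
      using that by (simp add: P_def Q_def scalar_prod_def lessThan_atLeast0 if_distrib cong: if_cong)
    also have "\<dots> = (\<Sum>m<card M. A i (e m) * B (e m) j)"
      using lt by (intro sum.mono_neutral_cong_right) auto
    also have "\<dots> = (\<Sum>m\<in>M. A i m * B m j)"
      by (rule sum.reindex_bij_betw[OF e])
    finally show ?thesis .
  qed
  \<comment> \<open>Column \<open>card M\<close> is the first one that consists of padding.\<close>
  have "P *\<^sub>v unit_vec h (card M) = 0\<^sub>v h"
  proof (rule eq_vecI)
    fix i assume "i < dim_vec (0\<^sub>v h :: real vec)"
    then have i: "i < h" by simp
    then have "(P *\<^sub>v unit_vec h (card M)) $ i = row P i \<bullet> unit_vec h (card M)"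
      using car by simp
    also have "\<dots> = row P i $ card M"
      using lt i car by (subst scalar_prod_right_unit) simp_all
    also have "\<dots> = 0" using i lt by (simp add: P_def)
    finally show "(P *\<^sub>v unit_vec h (card M)) $ i = 0\<^sub>v h $ i" using i by simp
  qed (simp add: P_def)
  then have "det P = 0"
    using det_0_iff_vec_prod_zero[OF car(1)] lt by (metis unit_vec_carrier unit_vec_nonzero)
  then have "det (P * Q) = 0" using det_mult[OF car] by simp
  moreover have "det (P * Q) = (\<Prod>i<h. (P * Q) $$ (i, i))"
  proof -
    have "upper_triangular (P * Q)"
      unfolding upper_triangular_def using PQ off car by auto
    from det_upper_triangular[OF this, of h] car show ?thesis
      by (simp add: diag_mat_def prod.list_conv_set_nth lessThan_atLeast0)
  qed
  moreover have "(P * Q) $$ (i, i) \<noteq> 0" if "i < h" for i using PQ[OF that that] diag[OF that] by simp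
  ultimately show False by simp
qed

text \<open>The entries of \<open>P - c\<^sup>2 I\<close>, where \<open>P\<close> is the orthogonal projection to the span of the orthonormal
  frame \<open>b\<close>.\<close>

definition shifted_projection :: "nat \<Rightarrow> (nat \<Rightarrow> real vec) \<Rightarrow> real \<Rightarrow> nat \<times> nat \<Rightarrow> real" where
  "shifted_projection k b c st =
     (\<Sum>l<k. b l $ fst st * b l $ snd st) - c\<^sup>2 * of_bool (fst st = snd st)"

lemma shifted_projection_form:
  assumes "x \<in> carrier_vec n" "y \<in> carrier_vec n" "\<And>l. l < k \<Longrightarrow> b l \<in> carrier_vec n"
  shows "(\<Sum>st\<in>{..<n} \<times> {..<n}. x $ fst st * y $ snd st * shifted_projection k b c st)
    = (\<Sum>l<k. (x \<bullet> b l) * (b l \<bullet> y)) - c\<^sup>2 * (x \<bullet> y)"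
proof -
  have dot: "p \<bullet> q = (\<Sum>s<n. p $ s * q $ s)" if "q \<in> carrier_vec n" for p q :: "real vec"
    using that by (auto simp: scalar_prod_def lessThan_atLeast0)
  have "(\<Sum>st\<in>{..<n} \<times> {..<n}. x $ fst st * y $ snd st * shifted_projection k b c st)
      = (\<Sum>s<n. \<Sum>t<n. x $ s * y $ t * ((\<Sum>l<k. b l $ s * b l $ t) - c\<^sup>2 * of_bool (s = t)))"
    by (simp add: sum.cartesian_product shifted_projection_def case_prod_unfold)
  also have "\<dots> = (\<Sum>s<n. \<Sum>t<n. \<Sum>l<k. (x $ s * b l $ s) * (b l $ t * y $ t))
      - (\<Sum>s<n. \<Sum>t<n. if t = s then c\<^sup>2 * (x $ s * y $ t) else 0)"
    unfolding sum_subtractf[symmetric]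
    by (intro sum.cong refl) (simp add: right_diff_distrib sum_distrib_left mult_ac)
  also have "(\<Sum>s<n. \<Sum>t<n. if t = s then c\<^sup>2 * (x $ s * y $ t) else 0) = c\<^sup>2 * (x \<bullet> y)"
    using assms(2) by (simp add: dot sum_distrib_left)
  also have "(\<Sum>s<n. \<Sum>t<n. \<Sum>l<k. (x $ s * b l $ s) * (b l $ t * y $ t))
      = (\<Sum>s<n. \<Sum>l<k. \<Sum>t<n. (x $ s * b l $ s) * (b l $ t * y $ t))"
    by (intro sum.cong refl sum.swap)
  also have "\<dots> = (\<Sum>l<k. \<Sum>s<n. \<Sum>t<n. (x $ s * b l $ s) * (b l $ t * y $ t))"
    by (rule sum.swap)
  also have "\<dots> = (\<Sum>l<k. (x \<bullet> b l) * (b l \<bullet> y))"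
    by (intro sum.cong refl) (simp add: dot assms(2,3) sum_product)
  finally show ?thesis .
qed

text \<open>The matrix with entries \<open>a\<^sub>i \<bullet> (P - c\<^sup>2 I) a\<^sub>j\<close>, where \<open>P\<close> is the orthogonal projection to the span
  of \<open>b\<close>.\<close>

definition compression :: "nat \<Rightarrow> (nat \<Rightarrow> real vec) \<Rightarrow> (nat \<Rightarrow> real vec) \<Rightarrow> real \<Rightarrow> real mat" where
  "compression k a b c = mat k k (\<lambda>(i, j).
     (\<Sum>l<k. (a i \<bullet> b l) * (b l \<bullet> a j)) - c\<^sup>2 * (a i \<bullet> a j))"

lemma compression_carrier: "compression k a b c \<in> carrier_mat k k"
  by (simp add: compression_def)

text \<open>The coordinates of \<open>u\<close> form a kernel vector: \<open>u\<close> projects to \<open>c v\<close> in \<open>V\<close>, which projects back to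
  \<open>c\<^sup>2 u\<close> in \<open>U\<close>.\<close>

lemma det_compression_singular_pair:
  assumes a: "orthonormal_basis n k a U" and b: "orthonormal_basis n k b V"
    and sp: "singular_pair U V c u v"
  shows "det (compression k a b c) = 0"
proof -
  have oa: "orthonormal n k a" and ob: "orthonormal n k b"
    using a b by (auto simp: orthonormal_basis_def)
  have u: "u \<in> U" "u \<bullet> u = 1" and v: "v \<in> V" and
    vx: "\<And>x. x \<in> U \<Longrightarrow> v \<bullet> x = c * (u \<bullet> x)" and uy: "\<And>y. y \<in> V \<Longrightarrow> u \<bullet> y = c * (v \<bullet> y)"
    using sp unfolding singular_pair_def by blast+
  have car: "u \<in> carrier_vec n" "v \<in> carrier_vec n" 
    using u(1) v orthonormal_basis_carrier[OF a] orthonormal_basis_carrier[OF b] by blast+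
  note ca = orthonormal_carrier[OF oa] and cb = orthonormal_carrier[OF ob]
  define w where "w = vec k (\<lambda>j. u \<bullet> a j)"
  have ue: "u = combination n k a (\<lambda>j. u \<bullet> a j)" by (rule orthonormal_basis_expand[OF a u(1)])
  have ve: "v = combination n k b (\<lambda>l. v \<bullet> b l)" by (rule orthonormal_basis_expand[OF b v])
  have u_sum: "x \<bullet> u = (\<Sum>j<k. (u \<bullet> a j) * (x \<bullet> a j))" if "x \<in> carrier_vec n" for x
    by (subst ue) (rule scalar_prod_combination[OF that ca])
  have v_sum: "x \<bullet> v = (\<Sum>l<k. (v \<bullet> b l) * (x \<bullet> b l))" if "x \<in> carrier_vec n" for x
    by (subst ve) (rule scalar_prod_combination[OF that cb])
  have "w \<noteq> 0\<^sub>v k"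
  proof
    assume "w = 0\<^sub>v k"
    then have "u \<bullet> a j = 0" if "j < k" for j
      using that by (auto simp: w_def dest!: arg_cong[where f = "\<lambda>x. x $ j"])
    then have "u \<bullet> u = 0" unfolding u_sum[OF car(1)] by simp
    with u(2) show False by simp
  qed
  moreover have "compression k a b c *\<^sub>v w = 0\<^sub>v k"
  proof (rule eq_vecI)
    fix i assume "i < dim_vec (0\<^sub>v k :: real vec)"
    then have i: "i < k" by simp
    have "(compression k a b c *\<^sub>v w) $ i
      = (\<Sum>j<k. ((\<Sum>l<k. (a i \<bullet> b l) * (b l \<bullet> a j)) - c\<^sup>2 * (a i \<bullet> a j)) * (u \<bullet> a j))"
      using i by (simp add: compression_def w_def scalar_prod_def lessThan_atLeast0)
    also have "\<dots> = (\<Sum>j<k. \<Sum>l<k. (a i \<bullet> b l) * ((u \<bullet> a j) * (b l \<bullet> a j)))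
        - c\<^sup>2 * (\<Sum>j<k. (u \<bullet> a j) * (a i \<bullet> a j))"
      by (simp add: left_diff_distrib right_diff_distrib sum_subtractf sum_distrib_left sum_distrib_right mult_ac)
    also have "(\<Sum>j<k. (u \<bullet> a j) * (a i \<bullet> a j)) = a i \<bullet> u"
      by (rule u_sum[OF ca[OF i], symmetric])
    also have "(\<Sum>j<k. \<Sum>l<k. (a i \<bullet> b l) * ((u \<bullet> a j) * (b l \<bullet> a j)))
        = (\<Sum>l<k. (a i \<bullet> b l) * (\<Sum>j<k. (u \<bullet> a j) * (b l \<bullet> a j)))"
      by (subst sum.swap) (simp only: sum_distrib_left)
    also have "\<dots> = (\<Sum>l<k. (a i \<bullet> b l) * (c * (v \<bullet> b l)))"
    proof (intro sum.cong refl arg_cong2[where f = times])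
      fix l assume "l \<in> {..<k}"
      then have l: "l < k" by simp
      have "(\<Sum>j<k. (u \<bullet> a j) * (b l \<bullet> a j)) = u \<bullet> b l"
        unfolding u_sum[OF cb[OF l], symmetric] by (rule comm_scalar_prod[OF cb[OF l] car(1)])
      also have "\<dots> = c * (v \<bullet> b l)" by (rule uy[OF orthonormal_basis_mem[OF b l]])
      finally show "(\<Sum>j<k. (u \<bullet> a j) * (b l \<bullet> a j)) = c * (v \<bullet> b l)" .
    qed
    also have "\<dots> = c * (a i \<bullet> v)"
      unfolding v_sum[OF ca[OF i]] by (simp add: sum_distrib_left mult_ac)
    also have "a i \<bullet> v = c * (a i \<bullet> u)"
      unfolding comm_scalar_prod[OF ca[OF i] car(1)] comm_scalar_prod[OF ca[OF i] car(2)]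
      by (rule vx[OF orthonormal_basis_mem[OF a i]])
    finally show "(compression k a b c *\<^sub>v w) $ i = 0\<^sub>v k $ i"
      using i by (simp add: power2_eq_square)
  qed (simp add: compression_def)
  ultimately show ?thesis
    using det_0_iff_vec_prod_zero[OF compression_carrier] by (metis w_def vec_carrier)
qed

lemma det_compression_self:
  assumes "orthonormal n k b"
  shows "det (compression k b b c) = (1 - c\<^sup>2) ^ k"
proof -
  have "compression k b b c = (1 - c\<^sup>2) \<cdot>\<^sub>m 1\<^sub>m k"
  proof (rule eq_matI)
    fix i j assume "i < dim_row ((1 - c\<^sup>2) \<cdot>\<^sub>m 1\<^sub>m k)" "j < dim_col ((1 - c\<^sup>2) \<cdot>\<^sub>m 1\<^sub>m k)"
    then have ij: "i < k" "j < k" by simp_all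
    have "(\<Sum>l<k. (b i \<bullet> b l) * (b l \<bullet> b j)) = (\<Sum>l<k. if l = i then of_bool (i = j) else 0)"
      using assms ij by (intro sum.cong refl) (auto simp: orthonormal_def)
    also have "\<dots> = of_bool (i = j)" using ij by simp
    finally show "compression k b b c $$ (i, j) = ((1 - c\<^sup>2) \<cdot>\<^sub>m 1\<^sub>m k) $$ (i, j)"
      using ij assms by (simp add: compression_def orthonormal_def)
  qed (simp_all add: compression_def)
  then show ?thesis by simp
qed

text \<open>Every entry of the matrix is linear in the \<open>n\<^sup>2\<close> entries of the shifted projection. Expanding the
  Leibniz formula over the choice \<open>\<phi>\<close> of one such entry per row separates \<open>a\<close>, which occurs only in the
  coefficients, from \<open>b\<close> and \<open>c\<close>, which occur only in the monomials.\<close>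

lemma det_compression_expansion:
  assumes "\<And>i. i < k \<Longrightarrow> a i \<in> carrier_vec n" "\<And>i. i < k \<Longrightarrow> b i \<in> carrier_vec n"
  shows "det (compression k a b c)
    = (\<Sum>\<phi>\<in>PiE {..<k} (\<lambda>_. {..<n} \<times> {..<n}).
        (\<Sum>p | p permutes {..<k}. signof p * (\<Prod>i<k. a i $ fst (\<phi> i) * a (p i) $ snd (\<phi> i)))
        * (\<Prod>i<k. shifted_projection k b c (\<phi> i)))"
proof -
  let ?Q = "{..<n} \<times> {..<n}"
  have prod: "(\<Prod>i<k. compression k a b c $$ (i, p i))
      = (\<Sum>\<phi>\<in>PiE {..<k} (\<lambda>_. ?Q). (\<Prod>i<k. a i $ fst (\<phi> i) * a (p i) $ snd (\<phi> i))
          * (\<Prod>i<k. shifted_projection k b c (\<phi> i)))" if p: "p permutes {..<k}" for p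
  proof -
    have "(\<Prod>i<k. compression k a b c $$ (i, p i))
      = (\<Prod>i<k. \<Sum>st\<in>?Q. a i $ fst st * a (p i) $ snd st * shifted_projection k b c st)"
    proof (rule prod.cong[OF refl])
      fix i assume "i \<in> {..<k}"
      then have i: "i < k" "p i < k" using permutes_in_image[OF p, of i] by auto
      have "compression k a b c $$ (i, p i)
        = (\<Sum>l<k. (a i \<bullet> b l) * (b l \<bullet> a (p i))) - c\<^sup>2 * (a i \<bullet> a (p i))"
        using i by (simp add: compression_def)
      also have "\<dots> = (\<Sum>st\<in>?Q. a i $ fst st * a (p i) $ snd st * shifted_projection k b c st)"
        by (rule shifted_projection_form[OF assms(1)[OF i(1)] assms(1)[OF i(2)] assms(2), symmetric])
      finally show "compression k a b c $$ (i, p i)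
        = (\<Sum>st\<in>?Q. a i $ fst st * a (p i) $ snd st * shifted_projection k b c st)" .
    qed
    also have "\<dots> = (\<Sum>\<phi>\<in>PiE {..<k} (\<lambda>_. ?Q).
        \<Prod>i<k. a i $ fst (\<phi> i) * a (p i) $ snd (\<phi> i) * shifted_projection k b c (\<phi> i))"
      by (rule prod_sum_PiE) auto
    finally show ?thesis by (simp only: prod.distrib)
  qed
  have "det (compression k a b c)
    = (\<Sum>p | p permutes {..<k}. signof p * (\<Prod>i<k. compression k a b c $$ (i, p i)))"
    using det_def'[OF compression_carrier, of k a b c] by (simp add: lessThan_atLeast0)
  also have "\<dots> = (\<Sum>p | p permutes {..<k}. \<Sum>\<phi>\<in>PiE {..<k} (\<lambda>_. ?Q).
      signof p * (\<Prod>i<k. a i $ fst (\<phi> i) * a (p i) $ snd (\<phi> i))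
          * (\<Prod>i<k. shifted_projection k b c (\<phi> i)))"
    by (intro sum.cong refl) (simp add: prod sum_distrib_left mult.assoc)
  also have "\<dots> = (\<Sum>\<phi>\<in>PiE {..<k} (\<lambda>_. ?Q). \<Sum>p | p permutes {..<k}.
      signof p * (\<Prod>i<k. a i $ fst (\<phi> i) * a (p i) $ snd (\<phi> i))
          * (\<Prod>i<k. shifted_projection k b c (\<phi> i)))"
    by (rule sum.swap)
  finally show ?thesis by (simp only: sum_distrib_right)
qed

text \<open>The determinants for pairs of members of \<open>H\<close> form a diagonal matrix with nonzero diagonal, and
  their expansion factors it through the \<open>n ^ (2 * k)\<close> monomials.\<close>

lemma common_singular_value_bound:
  assumes fin: "finite H" and H: "H \<subseteq> Gr k n" and c: "c\<^sup>2 \<noteq> 1"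
    and sp: "\<And>U V. U \<in> H \<Longrightarrow> V \<in> H \<Longrightarrow> U \<noteq> V \<Longrightarrow> \<exists>u v. singular_pair U V c u v"
  shows "card H \<le> n ^ (2 * k)"
proof -
  have "\<forall>U\<in>H. \<exists>b. orthonormal_basis n k b U"
    using H Gr_iff_orthonormal_basis by blast
  then obtain b where b: "\<And>U. U \<in> H \<Longrightarrow> orthonormal_basis n k (b U) U" by metis
  then have ob: "orthonormal n k (b U)" if "U \<in> H" for U
    using that by (simp add: orthonormal_basis_def)
  obtain e where e: "bij_betw e {..<card H} H"
    using ex_bij_betw_nat_finite[OF fin] by (auto simp: lessThan_atLeast0)
  then have eH: "e i \<in> H" if "i < card H" for i using that by (auto simp: bij_betw_def)
  let ?M = "PiE {..<k} (\<lambda>_. {..<n} \<times> {..<n})"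
  define A where "A = (\<lambda>i \<phi>. \<Sum>p | p permutes {..<k}.
      signof p * (\<Prod>j<k. b (e i) j $ fst (\<phi> j) * b (e i) (p j) $ snd (\<phi> j)))"
  define B where "B = (\<lambda>\<phi> i. \<Prod>j<k. shifted_projection k (b (e i)) c (\<phi> j))"
  have det: "(\<Sum>\<phi>\<in>?M. A i \<phi> * B \<phi> j) = det (compression k (b (e i)) (b (e j)) c)"
    if "i < card H" "j < card H" for i j
    unfolding A_def B_def
    by (rule det_compression_expansion[where a = "b (e i)" and b = "b (e j)", symmetric]; rule orthonormal_carrier[OF ob[OF eH]]; simp add: that)
  have "card H \<le> card ?M"
  proof (rule diagonal_factorization_bound)
    show "finite ?M" by (intro finite_PiE) auto
    show "(\<Sum>\<phi>\<in>?M. A i \<phi> * B \<phi> i) \<noteq> 0" if i: "i < card H" for i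
      unfolding det[OF i i] det_compression_self[OF ob[OF eH[OF i]]] using c by simp
    show "(\<Sum>\<phi>\<in>?M. A i \<phi> * B \<phi> j) = 0" if ij: "i < card H" "j < card H" "i \<noteq> j" for i j
    proof -
      have "e i \<noteq> e j" using e ij by (auto simp: bij_betw_def dest: inj_onD)
      then obtain u v where "singular_pair (e i) (e j) c u v" using sp eH ij by blast
      then show ?thesis unfolding det[OF ij(1,2)]
        by (rule det_compression_singular_pair[OF b[OF eH[OF ij(1)]] b[OF eH[OF ij(2)]]])
    qed
  qed
  also have "card ?M = n ^ (2 * k)"
    by (simp add: card_PiE card_cartesian_product power_mult power2_eq_square)
  finally show ?thesis .
qed

section \<open>Finite fields of characteristic two\<close>

type_synonym gf2_closure = "bit alg_closure"

lemma gf2_two: "(2 :: gf2_closure) = 0"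
  by (metis bit_2_eq_0 to_ac_0 to_ac_numeral)

lemma gf2_add_self: "(x :: gf2_closure) + x = 0"
  using gf2_two by (metis mult_2 mult_zero_left)

lemma gf2_add_self_left: "(x :: gf2_closure) + (x + y) = y"
  by (simp add: add.assoc[symmetric] gf2_add_self)

lemma gf2_add_eq_0: "(x :: gf2_closure) + y = 0 \<longleftrightarrow> x = y"
  by (metis gf2_add_self gf2_add_self_left add_0_right)

lemma gf2_power2_add: "((x :: gf2_closure) + y)\<^sup>2 = x\<^sup>2 + y\<^sup>2"
  by (simp add: power2_sum gf2_two)

lemma gf2_frobenius_add: "((x :: gf2_closure) + y) ^ (2 ^ i) = x ^ (2 ^ i) + y ^ (2 ^ i)"
proof (induction i)
  case (Suc i)
  have "z ^ (2 ^ Suc i) = (z ^ (2 ^ i))\<^sup>2" for z :: gf2_closure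
    by (simp add: power_mult[symmetric] mult.commute)
  then show ?case by (simp add: Suc gf2_power2_add)
qed simp

lemma gf2_power2_sum: "(\<Sum>i\<in>A. f i :: gf2_closure)\<^sup>2 = (\<Sum>i\<in>A. (f i)\<^sup>2)"
  by (induction A rule: infinite_finite_induct) (simp_all add: gf2_power2_add)

text \<open>The field with \<open>2 ^ r\<close> elements, as the fixed points of the \<open>r\<close>-fold Frobenius map in an algebraic
  closure of the field with two elements.\<close>

definition gf2_ext :: "nat \<Rightarrow> gf2_closure set" where
  "gf2_ext r = {x. x ^ (2 ^ r) = x}"

lemma gf2_ext_closed:
  "0 \<in> gf2_ext r" "1 \<in> gf2_ext r"
  "x \<in> gf2_ext r \<Longrightarrow> y \<in> gf2_ext r \<Longrightarrow> x + y \<in> gf2_ext r"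
  "x \<in> gf2_ext r \<Longrightarrow> y \<in> gf2_ext r \<Longrightarrow> x * y \<in> gf2_ext r"
  "x \<in> gf2_ext r \<Longrightarrow> inverse x \<in> gf2_ext r"
  by (simp_all add: gf2_ext_def gf2_frobenius_add power_mult_distrib power_inverse)

lemma bits_in_gf2_ext: "e \<in> {0, 1} \<Longrightarrow> e \<in> gf2_ext r"
  using gf2_ext_closed(1,2) by auto

text \<open>The elements are the roots of \<open>x ^ (2 ^ r) + x\<close>, which splits in the algebraic closure. Its
  derivative is the constant \<open>1\<close>, so the \<open>2 ^ r\<close> roots are distinct.\<close>

lemma card_gf2_ext:
  assumes "r \<ge> 1" shows "finite (gf2_ext r)" "card (gf2_ext r) = 2 ^ r"
proof -
  define p :: "gf2_closure poly" where "p = Polynomial.monom 1 (2 ^ r) + [:0, 1:]"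
  have pow: "(1::nat) < 2 ^ r" using assms by (intro one_less_power) simp_all
  have deg: "Polynomial.degree p = 2 ^ r"
    unfolding p_def using pow by (subst degree_add_eq_left) (simp_all add: degree_monom_eq)
  then have p0: "p \<noteq> 0" by auto
  have root: "poly p x = 0 \<longleftrightarrow> x \<in> gf2_ext r" for x
    by (simp add: p_def poly_monom gf2_ext_def gf2_add_eq_0)
  have "of_nat (2 ^ r) = (0 :: gf2_closure)" using assms by (simp add: gf2_two)
  then have der: "pderiv p = 1"
    by (simp add: p_def pderiv_add pderiv_monom pderiv_pCons one_pCons)
  obtain A where A: "size A = Polynomial.degree p" "p = Polynomial.smult (Polynomial.lead_coeff p) (\<Prod>x\<in>#A. [:- x, 1:])"
    using alg_closed_imp_factorization[OF p0] by blast
  have set: "set_mset A = gf2_ext r"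
  proof -
    have "poly p x = 0 \<longleftrightarrow> x \<in> set_mset A" for x
    proof -
      have "poly p x = Polynomial.lead_coeff p * (\<Prod>y\<in>#A. x - y)"
        by (subst A(2)) (simp add: poly_prod_mset image_mset.compositionality comp_def)
      then show ?thesis using p0 by auto
    qed
    then show ?thesis using root by blast
  qed
  have one: "count A x = 1" if x: "x \<in> set_mset A" for x
  proof (rule ccontr)
    assume ne: "count A x \<noteq> 1"
    obtain B where B: "A = add_mset x B" using x by (metis multi_member_split)
    have "x \<in># B" using ne B by (metis count_add_mset count_inI add_0 One_nat_def)
    then obtain D where D: "B = add_mset x D" by (metis multi_member_split)
    define q where "q = Polynomial.smult (Polynomial.lead_coeff p) (\<Prod>y\<in>#D. [:- y, 1:])"
    have p: "p = [:- x, 1:] * ([:- x, 1:] * q)"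
      by (subst A(2)) (simp add: B D q_def)
    have "poly (pderiv p) x = 0"
      unfolding p pderiv_mult poly_add poly_mult by simp
    then show False by (simp add: der)
  qed
  have "size A = (\<Sum>x\<in>set_mset A. count A x)" by (simp add: size_multiset_overloaded_eq)
  also have "\<dots> = card (gf2_ext r)" using one by (simp add: set)
  finally show "card (gf2_ext r) = 2 ^ r" using A(1) deg by simp
  show "finite (gf2_ext r)" using set by (metis finite_set_mset)
qed

definition gf2_trace :: "nat \<Rightarrow> gf2_closure \<Rightarrow> gf2_closure" where
  "gf2_trace r x = (\<Sum>i<r. x ^ (2 ^ i))"

lemma gf2_trace_add: "gf2_trace r (x + y) = gf2_trace r x + gf2_trace r y"
  by (simp add: gf2_trace_def gf2_frobenius_add sum.distrib)

lemma gf2_trace_0 [simp]: "gf2_trace r 0 = 0"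
  by (simp add: gf2_trace_def)

lemma gf2_trace_1: "odd r \<Longrightarrow> gf2_trace r 1 = 1"
  by (auto simp: gf2_trace_def gf2_two elim: oddE)

lemma gf2_idempotent_iff: "(t :: gf2_closure)\<^sup>2 = t \<longleftrightarrow> t \<in> {0, 1}"
  by (auto simp: power2_eq_square)

lemma sum_cyclic_shift:
  fixes a :: "nat \<Rightarrow> 'a :: ab_group_add"
  assumes "a r = a 0" shows "(\<Sum>i<r. a (Suc i)) = (\<Sum>i<r. a i)"
proof -
  have "a 0 + (\<Sum>i<r. a (Suc i)) = (\<Sum>i<r. a i) + a r"
    by (metis sum.lessThan_Suc sum.lessThan_Suc_shift)
  with assms show ?thesis by (simp add: add.commute)
qed

text \<open>Squaring permutes the conjugates \<open>x ^ (2 ^ i)\<close> cyclically, so the trace equals its own square.\<close>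

lemma gf2_trace_bit:
  assumes "x \<in> gf2_ext r" shows "gf2_trace r x \<in> {0, 1}"
proof -
  have "(gf2_trace r x)\<^sup>2 = (\<Sum>i<r. x ^ (2 ^ Suc i))"
    by (simp add: gf2_trace_def gf2_power2_sum power_mult[symmetric] mult.commute)
  also have "\<dots> = gf2_trace r x"
    unfolding gf2_trace_def using assms by (intro sum_cyclic_shift) (simp add: gf2_ext_def)
  finally show ?thesis by (simp only: gf2_idempotent_iff)
qed

lemma gf2_trace_scale: "e \<in> {0, 1} \<Longrightarrow> gf2_trace r (e * x) = e * gf2_trace r x"
  by auto

text \<open>Since \<open>r\<close> is odd, \<open>1\<close> has trace \<open>1\<close>; a nonzero \<open>c\<close> would be detected by its inverse.\<close>

lemma gf2_trace_nondegenerate: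
  assumes "odd r" "c \<in> gf2_ext r" "\<And>x. x \<in> gf2_ext r \<Longrightarrow> gf2_trace r (c * x) = 0"
  shows "c = 0"
  using assms(3)[OF gf2_ext_closed(5)[OF assms(2)]] gf2_trace_1[OF assms(1)]
  by (cases "c = 0") auto

text \<open>The second elementary symmetric function of \<open>a 0, \<dots>, a (r - 1)\<close>.\<close>

definition pair_sum :: "nat \<Rightarrow> (nat \<Rightarrow> 'a) \<Rightarrow> 'a :: comm_ring_1" where
  "pair_sum r a = (\<Sum>i<r. \<Sum>j<i. a i * a j)"

lemma pair_sum_add:
  "pair_sum r (\<lambda>i. a i + b i) + (\<Sum>i<r. a i * b i)
     = pair_sum r a + pair_sum r b + (\<Sum>i<r. a i) * (\<Sum>i<r. b i)"
  by (induction r)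
     (simp_all add: pair_sum_def algebra_simps sum.distrib sum_distrib_left)

lemma pair_sum_cyclic_shift:
  assumes "a r = a 0" shows "pair_sum r (\<lambda>i. a (Suc i)) = pair_sum r a"
proof -
  have shift: "pair_sum (Suc n) a = pair_sum n (\<lambda>i. a (Suc i)) + a 0 * (\<Sum>i<n. a (Suc i))" for n
  proof (induction n)
    case (Suc n)
    have "pair_sum (Suc (Suc n)) a = pair_sum (Suc n) a + (\<Sum>j<Suc n. a (Suc n) * a j)"
      by (simp add: pair_sum_def)
    also have "(\<Sum>j<Suc n. a (Suc n) * a j) = a (Suc n) * a 0 + (\<Sum>j<n. a (Suc n) * a (Suc j))"
      by (rule sum.lessThan_Suc_shift)
    finally show ?case unfolding Suc by (simp add: pair_sum_def algebra_simps)
  qed (simp add: pair_sum_def)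
  have "pair_sum r a + a r * (\<Sum>i<r. a i) = pair_sum (Suc r) a"
    by (simp add: pair_sum_def sum_distrib_left)
  then show ?thesis unfolding shift using sum_cyclic_shift[of a r] assms by simp
qed

text \<open>The second elementary symmetric function of the conjugates of \<open>x\<close>. On the field with \<open>2 ^ r\<close>
  elements it is a quadratic form over the field with two elements.\<close>

definition gf2_e2 :: "nat \<Rightarrow> gf2_closure \<Rightarrow> gf2_closure" where
  "gf2_e2 r x = pair_sum r (\<lambda>i. x ^ (2 ^ i))"

lemma gf2_e2_0 [simp]: "gf2_e2 r 0 = 0"
  by (simp add: gf2_e2_def pair_sum_def)

text \<open>Products \<open>x\<^sub>i y\<^sub>j\<close> of conjugates with \<open>i \<noteq> j\<close> make up the product of the traces except for the diagonal
  terms, which make up the trace of \<open>x * y\<close>.\<close>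

lemma gf2_e2_add:
  "gf2_e2 r (x + y) = gf2_e2 r x + gf2_e2 r y + gf2_trace r x * gf2_trace r y + gf2_trace r (x * y)"
proof -
  have "gf2_e2 r (x + y) + gf2_trace r (x * y)
      = gf2_e2 r x + gf2_e2 r y + gf2_trace r x * gf2_trace r y"
    unfolding gf2_e2_def gf2_trace_def gf2_frobenius_add power_mult_distrib by (rule pair_sum_add)
  then show ?thesis by (metis add.assoc add_0_right gf2_add_self)
qed

text \<open>As for the trace: a cyclic shift of the conjugates does not change a symmetric function.\<close>

lemma gf2_e2_bit:
  assumes "x \<in> gf2_ext r" shows "gf2_e2 r x \<in> {0, 1}"
proof -
  have "(gf2_e2 r x)\<^sup>2 = pair_sum r (\<lambda>i. x ^ (2 ^ Suc i))"
    by (simp add: gf2_e2_def pair_sum_def gf2_power2_sum power_mult_distrib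
        power_mult[symmetric] mult.commute)
  also have "\<dots> = gf2_e2 r x"
    unfolding gf2_e2_def using assms by (intro pair_sum_cyclic_shift) (simp add: gf2_ext_def)
  finally show ?thesis by (simp only: gf2_idempotent_iff)
qed

section \<open>Kerdock forms and equiangular lines\<close>

text \<open>The nontrivial additive character of the field with two elements.\<close>

definition bit_sign :: "gf2_closure \<Rightarrow> real" where
  "bit_sign t = (if t = 0 then 1 else -1)"

lemma bit_sign_add: "s \<in> {0, 1} \<Longrightarrow> t \<in> {0, 1} \<Longrightarrow> bit_sign (s + t) = bit_sign s * bit_sign t"
  by (auto simp: bit_sign_def gf2_add_self)

lemma gf2_bit_add: "s \<in> {0, 1} \<Longrightarrow> t \<in> {0, 1} \<Longrightarrow> s + t \<in> {0, 1 :: gf2_closure}"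
  by (auto simp: gf2_add_self)

lemma gf2_bit_mult: "s \<in> {0, 1} \<Longrightarrow> t \<in> {0, 1} \<Longrightarrow> s * t \<in> {0, 1 :: gf2_closure}"
  by auto

text \<open>Translation by \<open>z0\<close> permutes \<open>Z\<close> and reverses all signs.\<close>

lemma character_sum_zero:
  fixes Z :: "(gf2_closure \<times> gf2_closure) set"
  assumes closed: "\<And>z w. z \<in> Z \<Longrightarrow> w \<in> Z \<Longrightarrow> z + w \<in> Z"
    and h: "\<And>z. z \<in> Z \<Longrightarrow> h z \<in> {0, 1}" "\<And>z w. z \<in> Z \<Longrightarrow> w \<in> Z \<Longrightarrow> h (z + w) = h z + h w"
    and z0: "z0 \<in> Z" "h z0 \<noteq> 0"
  shows "(\<Sum>z\<in>Z. bit_sign (h z)) = 0"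
proof -
  \<comment> \<open>In characteristic two, translation by \<open>z0\<close> is an involution.\<close>
  have self: "z + z0 + z0 = z" for z by (cases z; cases z0) (simp add: add.assoc gf2_add_self)
  have "(\<Sum>z\<in>Z. bit_sign (h z)) = (\<Sum>z\<in>Z. bit_sign (h (z + z0)))"
    by (rule sum.reindex_bij_witness[of _ "\<lambda>z. z + z0" "\<lambda>z. z + z0"]) (auto simp: self closed z0(1))
  also have "\<dots> = (\<Sum>z\<in>Z. bit_sign (h z) * bit_sign (h z0))"
  proof (rule sum.cong[OF refl])
    fix z assume z: "z \<in> Z"
    show "bit_sign (h (z + z0)) = bit_sign (h z) * bit_sign (h z0)"
      unfolding h(2)[OF z z0(1)] by (rule bit_sign_add[OF h(1)[OF z] h(1)[OF z0(1)]])
  qed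
  also have "\<dots> = - (\<Sum>z\<in>Z. bit_sign (h z))"
    using z0(2) by (simp add: bit_sign_def sum_negf)
  finally show ?thesis by simp
qed

text \<open>The classical evaluation of a quadratic Gauss sum. In the square of the sum, substitute \<open>z + w\<close>
  for the second variable; the linear sum over \<open>z\<close> that then appears is \<open>0\<close> unless \<open>w\<close> is in the radical
  of the polarization \<open>B\<close>, that is, unless \<open>w = 0\<close>.\<close>

lemma bent_sum_squared:
  fixes Z :: "(gf2_closure \<times> gf2_closure) set"
  assumes closed: "0 \<in> Z" "\<And>z w. z \<in> Z \<Longrightarrow> w \<in> Z \<Longrightarrow> z + w \<in> Z" and fin: "finite Z"
    and f: "f 0 = 0" "\<And>z. z \<in> Z \<Longrightarrow> f z \<in> {0, 1}"
      "\<And>z w. z \<in> Z \<Longrightarrow> w \<in> Z \<Longrightarrow> f (z + w) = f z + f w + B z w"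
    and B: "\<And>z w. z \<in> Z \<Longrightarrow> w \<in> Z \<Longrightarrow> B z w \<in> {0, 1}"
      "\<And>z z' w. z \<in> Z \<Longrightarrow> z' \<in> Z \<Longrightarrow> w \<in> Z \<Longrightarrow> B (z + z') w = B z w + B z' w"
    and nondeg: "\<And>w. w \<in> Z \<Longrightarrow> (\<And>z. z \<in> Z \<Longrightarrow> B z w = 0) \<Longrightarrow> w = 0"
  shows "(\<Sum>z\<in>Z. bit_sign (f z))\<^sup>2 = real (card Z)"
proof -
  have self: "z + (z + w) = w" for z w :: "gf2_closure \<times> gf2_closure"
    by (cases z; cases w) (simp add: gf2_add_self_left)
  have "(\<Sum>z\<in>Z. bit_sign (f z))\<^sup>2 = (\<Sum>z\<in>Z. \<Sum>w\<in>Z. bit_sign (f z) * bit_sign (f w))"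
    by (simp add: power2_eq_square sum_product)
  also have "\<dots> = (\<Sum>z\<in>Z. \<Sum>w\<in>Z. bit_sign (f w) * bit_sign (B z w))"
  proof (rule sum.cong[OF refl])
    fix z assume z: "z \<in> Z"
    have "(\<Sum>w\<in>Z. bit_sign (f z) * bit_sign (f w)) = (\<Sum>w\<in>Z. bit_sign (f z) * bit_sign (f (z + w)))"
      by (rule sum.reindex_bij_witness[of _ "\<lambda>w. z + w" "\<lambda>w. z + w"]) (auto simp: self closed z)
    also have "\<dots> = (\<Sum>w\<in>Z. bit_sign (f w) * bit_sign (B z w))"
    proof (rule sum.cong[OF refl])
      fix w assume w: "w \<in> Z"
      have "bit_sign (f (z + w)) = bit_sign (f z) * bit_sign (f w) * bit_sign (B z w)"
        unfolding f(3)[OF z w]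
        by (simp only: bit_sign_add[OF gf2_bit_add[OF f(2)[OF z] f(2)[OF w]] B(1)[OF z w]]
            bit_sign_add[OF f(2)[OF z] f(2)[OF w]])
      moreover have "bit_sign (f z) * bit_sign (f z) = 1" by (simp add: bit_sign_def)
      ultimately show "bit_sign (f z) * bit_sign (f (z + w)) = bit_sign (f w) * bit_sign (B z w)"
        by (metis mult.assoc mult_1_left)
    qed
    finally show "(\<Sum>w\<in>Z. bit_sign (f z) * bit_sign (f w))
      = (\<Sum>w\<in>Z. bit_sign (f w) * bit_sign (B z w))" .
  qed
  also have "\<dots> = (\<Sum>w\<in>Z. bit_sign (f w) * (\<Sum>z\<in>Z. bit_sign (B z w)))"
    by (subst sum.swap) (simp add: sum_distrib_left)
  also have "\<dots> = (\<Sum>w\<in>Z. if w = 0 then real (card Z) else 0)"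
  proof (rule sum.cong[OF refl])
    fix w assume w: "w \<in> Z"
    show "bit_sign (f w) * (\<Sum>z\<in>Z. bit_sign (B z w)) = (if w = 0 then real (card Z) else 0)"
    proof (cases "w = 0")
      case True
      have "B z 0 = 0" if "z \<in> Z" for z
        using f(3)[OF that closed(1)] f(1) by simp
      then show ?thesis using True f(1) by (simp add: bit_sign_def)
    next
      case False
      then obtain z0 where "z0 \<in> Z" "B z0 w \<noteq> 0" using nondeg[OF w] by blast
      then have "(\<Sum>z\<in>Z. bit_sign (B z w)) = 0"
        using w by (intro character_sum_zero[where h = "\<lambda>z. B z w"] closed B)
      then show ?thesis using False by simp
    qed
  qed
  also have "\<dots> = real (card Z)" using fin closed(1) by simp
  finally show ?thesis .
qed

definition kerdock_domain :: "nat \<Rightarrow> (gf2_closure \<times> gf2_closure) set" where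
  "kerdock_domain r = gf2_ext r \<times> {0, 1}"

text \<open>The forms of the Kerdock set, indexed by the elements \<open>a\<close> of the field with \<open>2 ^ r\<close> elements.\<close>

definition kerdock_form :: "nat \<Rightarrow> gf2_closure \<Rightarrow> gf2_closure \<times> gf2_closure \<Rightarrow> gf2_closure" where
  "kerdock_form r a z = gf2_e2 r (a * fst z) + snd z * gf2_trace r (a * fst z)"

text \<open>The polarization of \<^const>\<open>kerdock_form\<close>.\<close>

definition kerdock_polar ::
  "nat \<Rightarrow> gf2_closure \<Rightarrow> gf2_closure \<times> gf2_closure \<Rightarrow> gf2_closure \<times> gf2_closure \<Rightarrow> gf2_closure" where
  "kerdock_polar r a z w =
     gf2_trace r (a * fst z) * gf2_trace r (a * fst w) + gf2_trace r (a * fst z * (a * fst w))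
     + snd z * gf2_trace r (a * fst w) + snd w * gf2_trace r (a * fst z)"

definition kerdock_linear :: "nat \<Rightarrow> gf2_closure \<times> gf2_closure \<Rightarrow> gf2_closure \<times> gf2_closure \<Rightarrow> gf2_closure" where
  "kerdock_linear r c z = gf2_trace r (fst c * fst z) + snd c * snd z"

lemma kerdock_form_add:
  "kerdock_form r a (z + w) = kerdock_form r a z + kerdock_form r a w + kerdock_polar r a z w"
  by (simp add: kerdock_form_def kerdock_polar_def distrib_left distrib_right
      gf2_e2_add gf2_trace_add add_ac mult_ac)

lemma kerdock_polar_add:
  "kerdock_polar r a (z + z') w = kerdock_polar r a z w + kerdock_polar r a z' w"
  by (simp add: kerdock_polar_def distrib_left distrib_right gf2_trace_add add_ac)

lemma kerdock_linear_add:
  "kerdock_linear r c (z + w) = kerdock_linear r c z + kerdock_linear r c w"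
  by (simp add: kerdock_linear_def distrib_left distrib_right gf2_trace_add add_ac)

lemma kerdock_linear_add_left:
  "kerdock_linear r (c + c') z = kerdock_linear r c z + kerdock_linear r c' z"
  by (simp add: kerdock_linear_def distrib_left distrib_right gf2_trace_add add_ac)

lemma kerdock_domain_closed:
  "0 \<in> kerdock_domain r"
  "z \<in> kerdock_domain r \<Longrightarrow> w \<in> kerdock_domain r \<Longrightarrow> z + w \<in> kerdock_domain r"
proof -
  show "0 \<in> kerdock_domain r" by (simp add: kerdock_domain_def gf2_ext_closed zero_prod_def)
  assume "z \<in> kerdock_domain r" "w \<in> kerdock_domain r"
  then show "z + w \<in> kerdock_domain r"
    unfolding kerdock_domain_def mem_Times_iff fst_add snd_add
    by (intro conjI gf2_ext_closed gf2_bit_add) simp_all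
qed

lemma card_kerdock_domain:
  assumes "r \<ge> 1" shows "finite (kerdock_domain r)" "card (kerdock_domain r) = 2 * 2 ^ r"
  using card_gf2_ext[OF assms] by (simp_all add: kerdock_domain_def card_cartesian_product)

lemma kerdock_bits:
  assumes "a \<in> gf2_ext r" "z \<in> kerdock_domain r" "w \<in> kerdock_domain r"
  shows "kerdock_form r a z \<in> {0, 1}" "kerdock_polar r a z w \<in> {0, 1}" "kerdock_linear r z w \<in> {0, 1}"
proof -
  have z: "fst z \<in> gf2_ext r" "snd z \<in> {0, 1}" "fst w \<in> gf2_ext r" "snd w \<in> {0, 1}"
    using assms by (simp_all only: kerdock_domain_def mem_Times_iff)
  note bits = gf2_bit_add gf2_bit_mult gf2_e2_bit gf2_trace_bit gf2_ext_closed(4)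
  show "kerdock_form r a z \<in> {0, 1}" "kerdock_polar r a z w \<in> {0, 1}" "kerdock_linear r z w \<in> {0, 1}"
    unfolding kerdock_form_def kerdock_polar_def kerdock_linear_def
    by (intro bits assms z)+
qed

text \<open>The defining property of a Kerdock set: the sum of two different members is nondegenerate. Let
  \<open>w = (y, e)\<close> be in the radical. The test vector \<open>(0, 1)\<close> shows that \<open>a * y\<close> and \<open>b * y\<close> have the same
  trace \<open>t\<close>. The test vectors \<open>(x, 0)\<close> then show that \<open>(a + b) * y\<close> is the bit \<open>t + e\<close>. Its trace is
  \<open>t + t = 0\<close>; but a bit is its own trace because \<open>r\<close> is odd. So \<open>(a + b) * y = 0\<close>, and \<open>y\<close>, \<open>t\<close> and \<open>e\<close>
  vanish in turn.\<close>

lemma kerdock_polar_sum_nondegenerate: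
  assumes r: "odd r" and ab: "a \<in> gf2_ext r" "b \<in> gf2_ext r" "a \<noteq> b" and w: "w \<in> kerdock_domain r"
    and zero: "\<And>z. z \<in> kerdock_domain r \<Longrightarrow> kerdock_polar r a z w + kerdock_polar r b z w = 0"
  shows "w = 0"
proof -
  obtain y e where ye: "w = (y, e)" "y \<in> gf2_ext r" "e \<in> {0, 1}"
    using w by (cases w) (simp add: kerdock_domain_def)
  define t where "t = gf2_trace r (a * y)"
  have t: "t \<in> {0, 1}" unfolding t_def by (intro gf2_trace_bit gf2_ext_closed ab ye)
  have "kerdock_polar r a (0, 1) w + kerdock_polar r b (0, 1) w = 0"
    by (rule zero) (simp add: kerdock_domain_def gf2_ext_closed)
  then have tb: "gf2_trace r (b * y) = t"
    by (simp add: kerdock_polar_def ye t_def gf2_add_eq_0)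
  \<comment> \<open>The trace form pairs this element with \<open>x\<close> to the value of the polarization at \<open>(x, 0)\<close>.\<close>
  have "(a + b) * (t + e + (a + b) * y) = 0"
  proof (rule gf2_trace_nondegenerate[OF r])
    show "(a + b) * (t + e + (a + b) * y) \<in> gf2_ext r"
      by (intro gf2_ext_closed ab ye bits_in_gf2_ext t)
    fix x assume x: "x \<in> gf2_ext r"
    have "(a + b) * ((a + b) * y) = a * (a * y) + b * (b * y)"
      using gf2_two by (simp add: algebra_simps gf2_add_self_left)
    then have "(a + b) * (t + e + (a + b) * y) * x
        = t * (a * x) + t * (b * x) + e * (a * x) + e * (b * x) + a * x * (a * y) + b * x * (b * y)"
      by (simp add: algebra_simps) (metis (no_types, lifting) distrib_left mult.assoc mult.commute)
    then have "gf2_trace r ((a + b) * (t + e + (a + b) * y) * x)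
        = t * gf2_trace r (a * x) + t * gf2_trace r (b * x) + e * gf2_trace r (a * x)
          + e * gf2_trace r (b * x) + gf2_trace r (a * x * (a * y)) + gf2_trace r (b * x * (b * y))"
      by (simp only: gf2_trace_add gf2_trace_scale[OF t] gf2_trace_scale[OF ye(3)])
    also have "\<dots> = kerdock_polar r a (x, 0) w + kerdock_polar r b (x, 0) w"
      by (simp add: kerdock_polar_def ye tb t_def[symmetric] algebra_simps)
    also have "\<dots> = 0" by (rule zero) (simp add: kerdock_domain_def x)
    finally show "gf2_trace r ((a + b) * (t + e + (a + b) * y) * x) = 0" .
  qed
  moreover have "a + b \<noteq> 0" using ab(3) by (simp add: gf2_add_eq_0)
  ultimately have eq: "t + e = (a + b) * y" by (simp add: gf2_add_eq_0)
  have "t + e = (t + e) * gf2_trace r 1" using gf2_trace_1[OF r] by simp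
  also have "\<dots> = gf2_trace r (t + e)"
    using gf2_trace_scale[OF gf2_bit_add[OF t ye(3)], of r 1] by simp
  also have "\<dots> = 0"
    unfolding eq by (simp add: distrib_right gf2_trace_add tb t_def[symmetric] gf2_add_self)
  finally have te: "t + e = 0" .
  with eq ab(3) have "y = 0" by (simp add: gf2_add_eq_0)
  then have "t = 0" by (simp add: t_def)
  with te have "e = 0" by simp
  with \<open>y = 0\<close> show ?thesis by (simp add: ye zero_prod_def)
qed

lemma kerdock_linear_nondegenerate:
  assumes r: "odd r" and c: "c \<in> kerdock_domain r" "c \<noteq> 0"
  shows "\<exists>z\<in>kerdock_domain r. kerdock_linear r c z \<noteq> 0"
proof (cases "snd c = 0")
  case False
  then show ?thesis
    by (intro bexI[of _ "(0, 1)"]) (simp_all add: kerdock_linear_def kerdock_domain_def gf2_ext_closed)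
next
  case True
  then have "fst c \<noteq> 0" using c(2) by (auto simp: prod_eq_iff)
  moreover have "fst c \<in> gf2_ext r" using c(1) by (auto simp: kerdock_domain_def)
  ultimately obtain x where "x \<in> gf2_ext r" "gf2_trace r (fst c * x) \<noteq> 0"
    using gf2_trace_nondegenerate[OF r] by blast
  then show ?thesis using True
    by (intro bexI[of _ "(x, 0)"]) (simp_all add: kerdock_linear_def kerdock_domain_def)
qed

text \<open>For fixed \<open>a\<close> these sign vectors are pairwise orthogonal; the bases that belong to different \<open>a\<close>
  are mutually unbiased.\<close>

definition kerdock_vector ::
  "nat \<Rightarrow> gf2_closure \<Rightarrow> gf2_closure \<times> gf2_closure \<Rightarrow> gf2_closure \<times> gf2_closure \<Rightarrow> real" where
  "kerdock_vector r a c z = bit_sign (kerdock_form r a z + kerdock_linear r c z)"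

lemma kerdock_vector_mult:
  assumes "a \<in> gf2_ext r" "b \<in> gf2_ext r"
    "c \<in> kerdock_domain r" "c' \<in> kerdock_domain r" "z \<in> kerdock_domain r"
  shows "kerdock_vector r a c z * kerdock_vector r b c' z
    = bit_sign (kerdock_form r a z + kerdock_form r b z + kerdock_linear r (c + c') z)"
proof -
  have "kerdock_vector r a c z * kerdock_vector r b c' z
    = bit_sign ((kerdock_form r a z + kerdock_linear r c z) + (kerdock_form r b z + kerdock_linear r c' z))"
    unfolding kerdock_vector_def
    by (rule bit_sign_add[symmetric]; intro gf2_bit_add kerdock_bits(1)[OF _ assms(5,5)] kerdock_bits(3)[OF assms(1) _ assms(5)] assms)
  then show ?thesis by (simp add: kerdock_linear_add_left add_ac)
qed

lemma kerdock_vector_same_form: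
  assumes r: "odd r" and a: "a \<in> gf2_ext r" and c: "c \<in> kerdock_domain r" "c' \<in> kerdock_domain r"
  shows "(\<Sum>z\<in>kerdock_domain r. kerdock_vector r a c z * kerdock_vector r a c' z)
    = (if c = c' then 2 * 2 ^ r else 0)"
proof -
  have eq: "(\<Sum>z\<in>kerdock_domain r. kerdock_vector r a c z * kerdock_vector r a c' z)
    = (\<Sum>z\<in>kerdock_domain r. bit_sign (kerdock_linear r (c + c') z))"
    using kerdock_vector_mult[OF a a c] by (simp add: gf2_add_self)
  have dup: "c + c = 0" for c :: "gf2_closure \<times> gf2_closure"
    by (cases c) (simp add: gf2_add_self zero_prod_def)
  show ?thesis
  proof (cases "c = c'")
    case True
    have "r \<ge> 1" using r by (cases r) auto
    then show ?thesis using True unfolding eq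
      by (simp add: dup kerdock_linear_def bit_sign_def card_kerdock_domain)
  next
    case False
    have "c + c' \<noteq> 0" using False dup[of c] by (metis add_left_cancel)
    then obtain z0 where z0: "z0 \<in> kerdock_domain r" "kerdock_linear r (c + c') z0 \<noteq> 0"
      using kerdock_linear_nondegenerate[OF r kerdock_domain_closed(2)[OF c]] by blast
    have "(\<Sum>z\<in>kerdock_domain r. bit_sign (kerdock_linear r (c + c') z)) = 0"
      by (rule character_sum_zero[where h = "kerdock_linear r (c + c')", OF kerdock_domain_closed(2)
          kerdock_bits(3)[OF a kerdock_domain_closed(2)[OF c]] kerdock_linear_add z0])
    then show ?thesis using False eq by simp
  qed
qed

lemma kerdock_vector_distinct_forms:
  assumes r: "odd r" and ab: "a \<in> gf2_ext r" "b \<in> gf2_ext r" "a \<noteq> b"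
    and c: "c \<in> kerdock_domain r" "c' \<in> kerdock_domain r"
  shows "(\<Sum>z\<in>kerdock_domain r. kerdock_vector r a c z * kerdock_vector r b c' z)\<^sup>2 = 2 * 2 ^ r"
proof -
  let ?f = "\<lambda>z. kerdock_form r a z + kerdock_form r b z + kerdock_linear r (c + c') z"
  have r1: "r \<ge> 1" using r by (cases r) auto
  have "(\<Sum>z\<in>kerdock_domain r. bit_sign (?f z))\<^sup>2 = real (card (kerdock_domain r))"
  proof (rule bent_sum_squared[where B = "\<lambda>z w. kerdock_polar r a z w + kerdock_polar r b z w"])
    show "?f 0 = 0" by (simp add: kerdock_form_def kerdock_linear_def)
    show "?f (z + w) = ?f z + ?f w + (kerdock_polar r a z w + kerdock_polar r b z w)" for z w
      unfolding kerdock_form_add kerdock_linear_add by (simp only: add_ac)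
    show "kerdock_polar r a (z + z') w + kerdock_polar r b (z + z') w =
       kerdock_polar r a z w + kerdock_polar r b z w + (kerdock_polar r a z' w + kerdock_polar r b z' w)"
      for z z' w by (simp add: kerdock_polar_add add_ac)
    show "?f z \<in> {0, 1}" if "z \<in> kerdock_domain r" for z
      by (intro gf2_bit_add kerdock_bits(1)[OF _ that that] kerdock_bits(3)[OF ab(1) _ that]
          kerdock_domain_closed ab c)
    show "kerdock_polar r a z w + kerdock_polar r b z w \<in> {0, 1}"
      if "z \<in> kerdock_domain r" "w \<in> kerdock_domain r" for z w
      by (intro gf2_bit_add kerdock_bits(2)[OF _ that] ab)
  qed (use kerdock_polar_sum_nondegenerate[OF r ab] kerdock_domain_closed card_kerdock_domain[OF r1] in blast)+
  then show ?thesis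
    using card_kerdock_domain[OF r1] kerdock_vector_mult[OF ab(1,2) c] by simp
qed

text \<open>Let \<open>N = 2 * 2 ^ r\<close> be the length of the sign vectors. Inner products are \<open>0\<close> within a basis and
  \<open>\<plusminus> sqrt N\<close> between different bases. A new coordinate for each basis, with value \<open>sqrt (sqrt N)\<close> on the
  vectors of that basis and \<open>0\<close> on all others, turns the \<open>0\<close> into \<open>sqrt N\<close> and the norms into
  \<open>N + sqrt N\<close>. This gives \<open>2 ^ r * N\<close> lines in dimension \<open>N + 2 ^ r\<close>.\<close>

theorem equiangular_lines:
  assumes r: "odd r"
  shows "\<exists>L :: nat \<Rightarrow> nat \<Rightarrow> real. \<forall>l < 2 * 4 ^ r. \<forall>m < 2 * 4 ^ r.
    (\<Sum>s<3 * 2 ^ r. L l s * L m s)\<^sup>2 = (if l = m then 1 else (1 / (sqrt (2 * 2 ^ r) + 1))\<^sup>2)"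
proof -
  have r1: "r \<ge> 1" using r by (cases r) auto
  define N :: real where "N = 2 * 2 ^ r"
  have N: "N > 0" by (simp add: N_def)
  let ?K = "gf2_ext r" and ?Z = "kerdock_domain r"
  define I where "I = Sum_Type.Plus ?Z ?K"
  define v where "v = (\<lambda>p q. case q of Inl z \<Rightarrow> kerdock_vector r (fst p) (snd p) z
      | Inr b \<Rightarrow> sqrt (sqrt N) * of_bool (fst p = b))"
  have fin: "finite ?Z" "finite ?K" "finite I" 
    and card: "card ?Z = 2 * 2 ^ r" "card ?K = 2 ^ r" "card I = 3 * 2 ^ r" "card (?K \<times> ?Z) = 2 * 4 ^ r"
    using card_kerdock_domain[OF r1] card_gf2_ext[OF r1]
    by (simp_all add: I_def card_Plus card_cartesian_product power_mult_distrib[symmetric])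
  have inner: "(\<Sum>q\<in>I. v p q * v p' q)
      = (\<Sum>z\<in>?Z. kerdock_vector r (fst p) (snd p) z * kerdock_vector r (fst p') (snd p') z)
        + sqrt N * of_bool (fst p = fst p')" if "p \<in> ?K \<times> ?Z" for p p'
  proof -
    have "(\<Sum>b\<in>?K. v p (Inr b) * v p' (Inr b))
        = (\<Sum>b\<in>?K. if b = fst p then sqrt N * of_bool (fst p = fst p') else 0)"
      using N by (intro sum.cong refl) (auto simp: v_def)
    also have "\<dots> = sqrt N * of_bool (fst p = fst p')"
      using that fin(2) by auto
    finally show ?thesis unfolding I_def using fin
      by (simp add: sum.Plus) (simp add: v_def)
  qed
  have sq: "(\<Sum>q\<in>I. v p q * v p' q)\<^sup>2 = (if p = p' then (N + sqrt N)\<^sup>2 else N)"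
    if p: "p \<in> ?K \<times> ?Z" "p' \<in> ?K \<times> ?Z" for p p'
  proof (cases "fst p = fst p'")
    case True
    then show ?thesis
      using p N kerdock_vector_same_form[OF r, of "fst p" "snd p" "snd p'"]
      by (auto simp: inner N_def prod_eq_iff mem_Times_iff)
  next
    case False
    then show ?thesis
      using p kerdock_vector_distinct_forms[OF r _ _ False, of "snd p" "snd p'"]
      by (auto simp: inner N_def mem_Times_iff)
  qed
  obtain g where g: "bij_betw g {..<3 * 2 ^ r :: nat} I"
    using ex_bij_betw_nat_finite[OF fin(3)] card(3) by (auto simp: lessThan_atLeast0)
  obtain h where h: "bij_betw h {..<2 * 4 ^ r :: nat} (?K \<times> ?Z)"
    using ex_bij_betw_nat_finite[of "?K \<times> ?Z"] fin card(4) by (auto simp: lessThan_atLeast0)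
  define L where "L = (\<lambda>l s. v (h l) (g s) / sqrt (N + sqrt N))"
  \<comment> \<open>All vectors had squared norm \<open>N + sqrt N\<close>, which \<open>L\<close> normalizes to \<open>1\<close>.\<close>
  have pos: "N + sqrt N > 0" using N by (simp add: add_pos_nonneg)
  have ratio: "N / (N + sqrt N)\<^sup>2 = (1 / (sqrt N + 1))\<^sup>2"
  proof -
    have "N + sqrt N = sqrt N * (sqrt N + 1)" using N by (simp add: algebra_simps)
    then show ?thesis using N by (simp add: power_mult_distrib power_divide)
  qed
  have "(\<Sum>s<3 * 2 ^ r. L l s * L m s)\<^sup>2 = (if l = m then 1 else (1 / (sqrt N + 1))\<^sup>2)"
    if lm: "l < 2 * 4 ^ r" "m < 2 * 4 ^ r" for l m :: nat
  proof -
    have "(\<Sum>s<3 * 2 ^ r. L l s * L m s) = (\<Sum>s<3 * 2 ^ r. v (h l) (g s) * v (h m) (g s)) / (N + sqrt N)"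
      using pos by (simp add: L_def sum_divide_distrib)
    also have "(\<Sum>s<3 * 2 ^ r. v (h l) (g s) * v (h m) (g s)) = (\<Sum>q\<in>I. v (h l) q * v (h m) q)"
      by (rule sum.reindex_bij_betw[OF g])
    finally have "(\<Sum>s<3 * 2 ^ r. L l s * L m s)\<^sup>2
        = (\<Sum>q\<in>I. v (h l) q * v (h m) q)\<^sup>2 / (N + sqrt N)\<^sup>2" by (simp add: power_divide)
    also have "\<dots> = (if h l = h m then (N + sqrt N)\<^sup>2 else N) / (N + sqrt N)\<^sup>2"
      using h lm by (subst sq) (auto simp: bij_betw_def)
    also have "\<dots> = (if l = m then 1 else (1 / (sqrt N + 1))\<^sup>2)"
      using h lm pos ratio by (auto simp: bij_betw_def dest: inj_onD)
    finally show ?thesis .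
  qed
  then show ?thesis unfolding N_def by blast
qed

section \<open>Direct sums of lines in orthogonal blocks\<close>

text \<open>The vector \<open>x\<close> of length \<open>M\<close>, moved to the \<open>i\<close>-th of the consecutive blocks of \<open>M\<close> coordinates.\<close>

definition block_vector :: "nat \<Rightarrow> nat \<Rightarrow> (nat \<Rightarrow> real) \<Rightarrow> nat \<Rightarrow> real vec" where
  "block_vector n M x i = vec n (\<lambda>s. if i * M \<le> s \<and> s < i * M + M then x (s - i * M) else 0)"

lemma block_vector_carrier [simp]: "block_vector n M x i \<in> carrier_vec n"
  by (simp add: block_vector_def)

lemma block_vector_scalar_prod:
  assumes "i < k" "k * M \<le> n"
  shows "block_vector n M x i \<bullet> block_vector n M y j = of_bool (i = j) * (\<Sum>s<M. x s * y s)"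
proof (cases "i = j")
  case True
  have "i * M + M \<le> k * M" using assms(1) by (metis Suc_leI mult_Suc add.commute mult_le_mono1)
  then have sub: "{i * M..<i * M + M} \<subseteq> {0..<n}" using assms(2) by auto
  have "block_vector n M x i \<bullet> block_vector n M y i
      = (\<Sum>s\<in>{0..<n}. if s \<in> {i * M..<i * M + M} then x (s - i * M) * y (s - i * M) else 0)"
    unfolding scalar_prod_def block_vector_def by (simp, intro sum.cong refl) auto
  also have "\<dots> = (\<Sum>s\<in>{i * M..<i * M + M}. x (s - i * M) * y (s - i * M))"
    using sub by (subst sum.inter_restrict[symmetric]) (auto simp: Int_absorb1)
  also have "\<dots> = (\<Sum>s<M. x s * y s)"
    by (rule sum.reindex_bij_witness[of _ "\<lambda>s. s + i * M" "\<lambda>s. s - i * M"]) auto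
  finally show ?thesis using True by simp
next
  case False
  have disjoint: "\<not> (i * M \<le> s \<and> s < i * M + M \<and> j * M \<le> s \<and> s < j * M + M)" for s
  proof
    assume s: "i * M \<le> s \<and> s < i * M + M \<and> j * M \<le> s \<and> s < j * M + M"
    then have "s div M = i" "s div M = j"
      by (auto intro!: div_nat_eqI simp: mult.commute)
    with False show False by simp
  qed
  then have "block_vector n M x i \<bullet> block_vector n M y j = 0"
    unfolding scalar_prod_def block_vector_def by (intro sum.neutral) auto
  with False show ?thesis by simp
qed

text \<open>The matrix of inner products between the two frames is diagonal, so its singular values are the
  absolute values of its diagonal entries.\<close>

lemma singular_value_of_aligned_frames:
  assumes a: "orthonormal_basis n k a U" and b: "orthonormal_basis n k b V"
    and ortho: "\<And>i j. i < k \<Longrightarrow> j < k \<Longrightarrow> i \<noteq> j \<Longrightarrow> a i \<bullet> b j = 0"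
    and sp: "singular_pair U V c u v"
  shows "\<exists>i<k. c\<^sup>2 = (a i \<bullet> b i)\<^sup>2"
proof -
  have oa: "orthonormal n k a" and ob: "orthonormal n k b"
    using a b by (auto simp: orthonormal_basis_def)
  note ca = orthonormal_carrier[OF oa] and cb = orthonormal_carrier[OF ob]
  have u: "u \<in> U" "u \<bullet> u = 1" and v: "v \<in> V" and
    vx: "\<And>x. x \<in> U \<Longrightarrow> v \<bullet> x = c * (u \<bullet> x)" and uy: "\<And>y. y \<in> V \<Longrightarrow> u \<bullet> y = c * (v \<bullet> y)"
    using sp unfolding singular_pair_def by blast+
  obtain p where p: "u = combination n k a p" using u(1) a by (auto simp: orthonormal_basis_def)
  obtain q where q: "v = combination n k b q" using v b by (auto simp: orthonormal_basis_def)
  have "(\<Sum>i<k. p i * p i) = 1" using u(2) unfolding p scalar_prod_combinations[OF oa] .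
  then obtain j where j: "j < k" "p j \<noteq> 0"
    by (metis (no_types, lifting) lessThan_iff mult_zero_left sum.neutral zero_neq_one)
  have pj: "u \<bullet> a j = p j" and qj: "v \<bullet> b j = q j"
    unfolding p q using oa ob j(1) by (simp_all add: orthonormal_coefficient)
  have "u \<bullet> b j = (\<Sum>i<k. p i * (a i \<bullet> b j))"
    unfolding p by (rule combination_scalar_prod[OF cb[OF j(1)] ca])
  also have "\<dots> = (\<Sum>i<k. if i = j then p j * (a j \<bullet> b j) else 0)"
    using ortho j(1) by (intro sum.cong refl) simp
  finally have 1: "p j * (a j \<bullet> b j) = c * q j"
    using uy[OF orthonormal_basis_mem[OF b j(1)]] j(1) by (simp add: qj)
  have "v \<bullet> a j = (\<Sum>i<k. q i * (b i \<bullet> a j))"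
    unfolding q by (rule combination_scalar_prod[OF ca[OF j(1)] cb])
  also have "\<dots> = (\<Sum>i<k. if i = j then q j * (a j \<bullet> b j) else 0)"
    using ortho j(1) by (intro sum.cong refl) (simp add: comm_scalar_prod[OF cb ca])
  finally have 2: "q j * (a j \<bullet> b j) = c * p j"
    using vx[OF orthonormal_basis_mem[OF a j(1)]] j(1) by (simp add: pj)
  have "p j * (a j \<bullet> b j)\<^sup>2 = c * (q j * (a j \<bullet> b j))"
    using 1 by (simp add: power2_eq_square mult.assoc[symmetric])
  also have "\<dots> = p j * c\<^sup>2" unfolding 2 by (simp add: power2_eq_square)
  finally have "c\<^sup>2 = (a j \<bullet> b j)\<^sup>2" using j(2) by simp
  with j(1) show ?thesis by blast
qed

text \<open>For each choice \<open>\<phi>\<close> of one line per block, take the direct sum of the lines. A singular value of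
  two such sums is \<open>1\<close> or \<open>g\<close>; a proper angle distance excludes \<open>1\<close> for different sums.\<close>

lemma max_equidistant_lower_bound:
  fixes L :: "nat \<Rightarrow> nat \<Rightarrow> real"
  assumes d: "proper_angle_distance k n d" and n: "k * M \<le> n"
    and g: "0 < g" "g < 1"
    and L: "\<And>l m. l < Q \<Longrightarrow> m < Q \<Longrightarrow>
      (\<Sum>s<M. L l s * L m s)\<^sup>2 = (if l = m then 1 else g\<^sup>2)"
  shows "enat (Q ^ k) \<le> max_equidistant d k n"
proof -
  let ?P = "PiE {..<k} (\<lambda>_. {..<Q})"
  define w where "w = (\<lambda>\<phi> i. block_vector n M (L (\<phi> i)) i)"
  define U where "U = (\<lambda>\<phi>. range (combination n k (w \<phi>)))"
  have P: "\<phi> i < Q" if "\<phi> \<in> ?P" "i < k" for \<phi> i using that by (auto simp: PiE_iff)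
  have L1: "(\<Sum>s<M. L l s * L l s) = 1" if "l < Q" for l
  proof -
    have "(\<Sum>s<M. L l s * L l s) \<ge> 0" by (intro sum_nonneg) simp
    then show ?thesis using L[OF that that] by (simp add: power2_eq_1_iff)
  qed
  have ortho: "w \<phi> i \<bullet> w \<psi> j = 0" if "i < k" "i \<noteq> j" for \<phi> \<psi> i j
    using that block_vector_scalar_prod[OF that(1) n] by (simp add: w_def)
  have diag: "(w \<phi> i \<bullet> w \<psi> i)\<^sup>2 = (if \<phi> i = \<psi> i then 1 else g\<^sup>2)"
    if "\<phi> \<in> ?P" "\<psi> \<in> ?P" "i < k" for \<phi> \<psi> i
    using block_vector_scalar_prod[OF that(3) n] L P that by (simp add: w_def)
  have basis: "orthonormal_basis n k (w \<phi>) (U \<phi>)" if "\<phi> \<in> ?P" for \<phi>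
    unfolding orthonormal_basis_def orthonormal_def U_def
    using that ortho block_vector_scalar_prod[OF _ n] L1 P by (auto simp: w_def)
  then have Gr: "U \<phi> \<in> Gr k n" if "\<phi> \<in> ?P" for \<phi>
    using that orthonormal_basis_imp_Gr by blast
  have inj: "inj_on U ?P"
  proof (rule inj_onI)
    fix \<phi> \<psi> assume pp: "\<phi> \<in> ?P" "\<psi> \<in> ?P" and eq: "U \<phi> = U \<psi>"
    show "\<phi> = \<psi>"
    proof (rule PiE_ext[OF pp])
      fix i assume "i \<in> {..<k}"
      then have i: "i < k" by simp
      have "w \<psi> i \<in> U \<phi>" unfolding eq by (rule orthonormal_basis_mem[OF basis[OF pp(2)] i])
      from orthonormal_basis_expand[OF basis[OF pp(1)] this]
      have "w \<psi> i \<bullet> w \<psi> i = combination n k (w \<phi>) (\<lambda>j. w \<psi> i \<bullet> w \<phi> j) \<bullet> w \<psi> i"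
        by (rule arg_cong)
      also have "\<dots> = (\<Sum>j<k. (w \<psi> i \<bullet> w \<phi> j) * (w \<phi> j \<bullet> w \<psi> i))"
        by (rule combination_scalar_prod) (simp_all add: w_def)
      also have "\<dots> = (\<Sum>j<k. if j = i then (w \<psi> i \<bullet> w \<phi> i) * (w \<phi> i \<bullet> w \<psi> i) else 0)"
        using ortho i by (intro sum.cong refl) simp
      also have "\<dots> = (w \<phi> i \<bullet> w \<psi> i)\<^sup>2"
        using i by (simp add: power2_eq_square w_def comm_scalar_prod[OF block_vector_carrier block_vector_carrier])
      finally have "(w \<phi> i \<bullet> w \<psi> i)\<^sup>2 = 1"
        using basis[OF pp(2)] i by (simp add: orthonormal_basis_def orthonormal_def)
      moreover have "g\<^sup>2 \<noteq> 1" using g by (simp add: power2_eq_1_iff)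
      ultimately show "\<phi> i = \<psi> i" using diag[OF pp i] by (metis)
    qed
  qed
  have dist: "d V W = arccos g" if V: "V \<in> U ` ?P" and W: "W \<in> U ` ?P" and "V \<noteq> W" for V W
  proof -
    obtain \<phi> \<psi> where pp: "\<phi> \<in> ?P" "\<psi> \<in> ?P" "V = U \<phi>" "W = U \<psi>" using V W by blast
    have VW: "V \<in> Gr k n" "W \<in> Gr k n" using Gr pp by auto
    have "d V W \<noteq> 0" and "d V W \<in> (\<lambda>i. principal_angle i V W) ` {..<k}"
      using d VW \<open>V \<noteq> W\<close> unfolding proper_angle_distance_def angle_distance_def by blast+
    then obtain i where "i < k" "d V W = principal_angle i V W" by blast
    then obtain c u v where c: "singular_pair V W c u v" "0 \<le> c" "c \<le> 1" "d V W = arccos c"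
      using principal_angle_singular_pair[OF VW] by metis
    obtain j where j: "j < k" "c\<^sup>2 = (w \<phi> j \<bullet> w \<psi> j)\<^sup>2"
      using singular_value_of_aligned_frames[OF basis[OF pp(1)] basis[OF pp(2)] ortho] c(1) pp by metis
    have "c \<noteq> 1" using c(4) \<open>d V W \<noteq> 0\<close> by auto
    then have "c\<^sup>2 \<noteq> 1" using c(2) by (simp add: power2_eq_1_iff)
    then have "c\<^sup>2 = g\<^sup>2" using j diag[OF pp(1,2) j(1)] by metis
    then have "c = g" using c(2) g(1) by (simp)
    then show ?thesis using c(4) by simp
  qed
  have "U ` ?P \<in> equidistant_sets d (arccos g) k n"
    using Gr dist by (auto simp: equidistant_sets_def pairwise_def)
  then have "set_size (U ` ?P) \<le> max_equidistant_at d (arccos g) k n"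
    unfolding max_equidistant_at_def by (rule SUP_upper)
  also have "\<dots> \<le> max_equidistant d k n"
    unfolding max_equidistant_def by (rule SUP_upper) simp
  also have "set_size (U ` ?P) = enat (Q ^ k)"
  proof -
    have "finite ?P" by (intro finite_PiE) auto
    then show ?thesis by (simp add: set_size_def card_image[OF inj] card_PiE)
  qed
  finally show ?thesis .
qed

section \<open>Equidistant families of subspaces\<close>

text \<open>All pairs share the singular value \<open>cos \<alpha>\<close>, which is not \<open>1\<close> because a proper angle distance is
  positive on different subspaces.\<close>

lemma equidistant_card_le:
  assumes d: "proper_angle_distance k n d" and "n \<ge> 1"
    and H: "H \<in> equidistant_sets d \<alpha> k n" "finite H"
  shows "card H \<le> n ^ (2 * k)"
proof (cases "\<exists>V\<in>H. \<exists>W\<in>H. V \<noteq> W")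
  case False
  then have "card H \<le> 1" using H(2) by (metis card_le_Suc0_iff_eq One_nat_def)
  also have "1 \<le> n ^ (2 * k)" using assms(2) by (rule one_le_power)
  finally show ?thesis .
next
  case True
  have HG: "H \<subseteq> Gr k n" and eq: "\<And>V W. V \<in> H \<Longrightarrow> W \<in> H \<Longrightarrow> V \<noteq> W \<Longrightarrow> d V W = \<alpha>"
    using H(1) by (auto simp: equidistant_sets_def pairwise_def)
  have ang: "\<exists>c u v. singular_pair V W c u v \<and> 0 \<le> c \<and> c \<le> 1 \<and> \<alpha> = arccos c"
    if neq: "V \<in> H" "W \<in> H" "V \<noteq> W" for V W
  proof -
    have VW: "V \<in> Gr k n" "W \<in> Gr k n" using neq(1,2) HG by auto
    obtain i where "i < k" "\<alpha> = principal_angle i V W"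
      using d VW eq[OF neq] unfolding proper_angle_distance_def angle_distance_def by blast
    then show ?thesis using principal_angle_singular_pair[OF VW] by metis
  qed
  have sp: "\<exists>u v. singular_pair V W (cos \<alpha>) u v" if neq: "V \<in> H" "W \<in> H" "V \<noteq> W" for V W
  proof -
    obtain c u v where c: "singular_pair V W c u v" "0 \<le> c" "c \<le> 1" "\<alpha> = arccos c"
      using ang[OF neq] by blast
    then have "cos \<alpha> = c" by simp
    then show ?thesis using c(1) by blast
  qed
  obtain V W where VW: "V \<in> H" "W \<in> H" "V \<noteq> W" using True by blast
  obtain c where c: "0 \<le> c" "c \<le> 1" "\<alpha> = arccos c" using ang[OF VW] by blast
  have "\<alpha> \<noteq> 0" using d VW eq[OF VW] HG unfolding proper_angle_distance_def by blast
  then have "c \<noteq> 1" using c(3) by auto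
  then have "(cos \<alpha>)\<^sup>2 \<noteq> 1" using c by (simp add: power2_eq_1_iff)
  then show ?thesis by (rule common_singular_value_bound[OF H(2) HG _ sp])
qed

lemma max_equidistant_upper_bound:
  assumes d: "proper_angle_distance k n d" and n: "n \<ge> 1"
  shows "max_equidistant d k n \<le> enat (n ^ (2 * k))"
  unfolding max_equidistant_def max_equidistant_at_def
proof (intro SUP_least)
  fix \<alpha> H assume H: "H \<in> equidistant_sets d \<alpha> k n"
  have "finite H"
  proof (rule ccontr)
    assume "infinite H"
    then obtain H' where H': "H' \<subseteq> H" "finite H'" "card H' = Suc (n ^ (2 * k))"
      using infinite_arbitrarily_large by blast
    then have "H' \<in> equidistant_sets d \<alpha> k n"
      using H by (auto simp: equidistant_sets_def intro: pairwise_subset)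
    from equidistant_card_le[OF d n this H'(2)] H'(3) show False by simp
  qed
  then show "set_size H \<le> enat (n ^ (2 * k))"
    using equidistant_card_le[OF d n H] by (simp add: set_size_def)
qed

text \<open>Blocks of dimension \<open>3 * 2 ^ r\<close> with \<open>r = 2 * t + 1\<close> have the form \<open>6 * 4 ^ t\<close>. These sizes grow by
  the factor \<open>4\<close>, so filling \<open>n\<close> coordinates with \<open>k\<close> blocks of the largest size that fits loses only a
  constant factor.\<close>

lemma max_equidistant_lower_bound_power:
  assumes k: "k \<ge> 1" and d: "proper_angle_distance k n d" and n: "n \<ge> 6 * k"
  shows "ereal ((1 / (72 * (real k)\<^sup>2)) ^ k * real n ^ (2 * k)) \<le> ereal_of_enat (max_equidistant d k n)"
proof -
  \<comment> \<open>The least \<open>t\<close> for which \<open>k\<close> blocks of the next size, \<open>6 * 4 ^ (t + 1) = 24 * 4 ^ t\<close>, do not fit.\<close>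
  define t where "t = (LEAST t. n < 24 * 4 ^ t * k)"
  have "n < 24 * 4 ^ n * k"
  proof -
    have "n < 4 ^ n" by (rule power_gt_expt) simp
    also have "4 ^ n \<le> 24 * 4 ^ n * k" using k by (simp add: Suc_le_eq)
    finally show ?thesis .
  qed
  then have upper: "n < 24 * 4 ^ t * k" unfolding t_def by (rule LeastI)
  have lower: "6 * 4 ^ t * k \<le> n"
  proof (cases t)
    case 0
    then show ?thesis using n by simp
  next
    case (Suc t')
    then have "\<not> n < 24 * 4 ^ t' * k" using not_less_Least[of t' "\<lambda>t. n < 24 * 4 ^ t * k"] by (simp add: t_def)
    then show ?thesis using Suc by simp
  qed
  define r where "r = 2 * t + 1"
  have r: "odd r" and "(2::nat) ^ r = 2 * 4 ^ t" by (simp_all add: r_def power_mult)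
  define g where "g = 1 / (sqrt (2 * 2 ^ r) + 1)"
  have "sqrt (2 * 2 ^ r) > 0" by (simp only: real_sqrt_gt_0_iff) simp
  then have g: "0 < g" "g < 1"
    unfolding g_def by (simp_all del: real_sqrt_gt_0_iff add: add_pos_pos)
  obtain L :: "nat \<Rightarrow> nat \<Rightarrow> real" where L: "\<And>l m. l < 2 * 4 ^ r \<Longrightarrow> m < 2 * 4 ^ r \<Longrightarrow>
    (\<Sum>s<3 * 2 ^ r. L l s * L m s)\<^sup>2 = (if l = m then 1 else g\<^sup>2)"
    using equiangular_lines[OF r] unfolding g_def by blast
  have "k * (3 * 2 ^ r) \<le> n" using lower by (simp add: \<open>2 ^ r = _\<close> mult_ac)
  from max_equidistant_lower_bound[OF d this g L]
  have Q: "enat ((2 * 4 ^ r) ^ k) \<le> max_equidistant d k n" .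
  have "real n \<le> 24 * 4 ^ t * real k"
    using of_nat_mono[where 'a = real, OF less_imp_le[OF upper]] by simp
  then have "(real n)\<^sup>2 \<le> (24 * 4 ^ t * real k)\<^sup>2" by (rule power_mono) simp
  \<comment> \<open>Here \<open>4 ^ r = 4 * 16 ^ t\<close> and \<open>24\<^sup>2 = 576 = 72 * 8\<close>.\<close>
  also have "\<dots> = 72 * (real k)\<^sup>2 * (2 * 4 ^ r)"
  proof -
    have "(4::real) ^ t * 4 ^ t = 16 ^ t" by (simp add: power_mult_distrib[symmetric])
    then show ?thesis by (simp add: r_def power_mult_distrib power_mult power2_eq_square)
  qed
  finally have "1 / (72 * (real k)\<^sup>2) * (real n)\<^sup>2 \<le> 2 * 4 ^ r"
    using k by (simp add: field_simps)
  then have "(1 / (72 * (real k)\<^sup>2) * (real n)\<^sup>2) ^ k \<le> (2 * 4 ^ r) ^ k"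
    by (rule power_mono) simp
  moreover have "(1 / (72 * (real k)\<^sup>2)) ^ k * real n ^ (2 * k)
      = (1 / (72 * (real k)\<^sup>2) * (real n)\<^sup>2) ^ k"
    by (simp only: power_mult_distrib power_mult)
  ultimately have "ereal ((1 / (72 * (real k)\<^sup>2)) ^ k * real n ^ (2 * k)) \<le> ereal_of_enat (enat ((2 * 4 ^ r) ^ k))"
    by (simp only: ereal_of_enat_simps ereal_less_eq of_nat_power of_nat_mult of_nat_numeral)
  also have "\<dots> \<le> ereal_of_enat (max_equidistant d k n)"
    using Q by (simp only: ereal_of_enat_le_iff)
  finally show ?thesis .
qed

theorem corollary1:
  fixes k :: nat
    and d :: "nat \<Rightarrow> real vec set \<Rightarrow> real vec set \<Rightarrow> real"
  assumes "k \<ge> 1"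
    and "\<And>n. n \<ge> k \<Longrightarrow> proper_angle_distance k n (d n)"
  shows "\<exists>c > 0. \<exists>C > 0. \<exists>n0 :: nat. \<forall>n \<ge> n0.
    ereal (c * real n ^ (2 * k)) \<le> ereal_of_enat (max_equidistant (d n) k n) \<and>
    ereal_of_enat (max_equidistant (d n) k n) \<le> ereal (C * real n ^ (2 * k))"
proof (intro exI conjI allI impI)
  show "(1 / (72 * (real k)\<^sup>2)) ^ k > 0" using assms(1) by simp
  show "(1::real) > 0" by simp
  fix n assume n: "n \<ge> 6 * k"
  then have d: "proper_angle_distance k n (d n)" by (intro assms(2)) simp
  show "ereal ((1 / (72 * (real k)\<^sup>2)) ^ k * real n ^ (2 * k)) \<le> ereal_of_enat (max_equidistant (d n) k n)"
    by (rule max_equidistant_lower_bound_power[OF assms(1) d n])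
  have "max_equidistant (d n) k n \<le> enat (n ^ (2 * k))"
    using n assms(1) by (intro max_equidistant_upper_bound d) simp
  then have "ereal_of_enat (max_equidistant (d n) k n) \<le> ereal_of_enat (enat (n ^ (2 * k)))"
    by (simp only: ereal_of_enat_le_iff)
  then show "ereal_of_enat (max_equidistant (d n) k n) \<le> ereal (1 * real n ^ (2 * k))" by simp
qed

end
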